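(* Let $G$ be a finitely generated group and let $N$ be a subgroup of $\mathfrak{X}(G)$ that contains the commutator subgroup $\mathfrak{X}(G)'$. Then $N$ is finitely generated if and only if $\pi_1(N)$, $\pi_2(N)$ and $\pi_3(N)$ are all finitely generated. In particular, $\mathfrak{X}(G)'$ is finitely generated if and only if $G'$ is finitely generated.
   Context: For a group $G$ let $\overline{G}$ be an isomorphic copy of $G$, with $\overline{g}$ the image of $g \in G$, and let $\mathfrak{X}(G) = \langle G, \overline{G} \mid [g, \overline{g}] = 1 \text{ for } g \in G\rangle$. The epimorphisms $\pi_1, \pi_2, \pi_3 : \mathfrak{X}(G) \to G$ are defined for $g \in G$ by: $\pi_1(g) = g$, $\pi_1(\overline{g}) = 1$; $\pi_2(g) = 1$, $\pi_2(\overline{g}) = g$; $\pi_3(g) = \pi_3(\overline{g}) = g$. For a group $H$, $H' = [H,H]$. *)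

theory Defs
  imports "HOL-Algebra.Generated_Groups"
begin

section \<open>Groups given by generators and relators\<close>

text \<open>The letter \<open>(x, True)\<close> stands for the generator \<open>x\<close> and \<open>(x, False)\<close> for its formal inverse.\<close>

type_synonym 'x word = "('x \<times> bool) list"

definition words :: "'x set \<Rightarrow> 'x word set" where
  "words X = lists (X \<times> UNIV)"

definition word_inv :: "'x word \<Rightarrow> 'x word" where
  "word_inv w = rev (map (\<lambda>(x, e). (x, \<not> e)) w)"

inductive pres_eq :: "'x set \<Rightarrow> 'x word set \<Rightarrow> 'x word \<Rightarrow> 'x word \<Rightarrow> bool" for X R where
  refl: "w \<in> words X \<Longrightarrow> pres_eq X R w w"
| sym: "pres_eq X R v w \<Longrightarrow> pres_eq X R w v"
| trans: "pres_eq X R u v \<Longrightarrow> pres_eq X R v w \<Longrightarrow> pres_eq X R u w"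
| cancel: "u \<in> words X \<Longrightarrow> v \<in> words X \<Longrightarrow> x \<in> X
    \<Longrightarrow> pres_eq X R (u @ [(x, e), (x, \<not> e)] @ v) (u @ v)"
| relator: "u \<in> words X \<Longrightarrow> v \<in> words X \<Longrightarrow> r \<in> R \<Longrightarrow> r \<in> words X
    \<Longrightarrow> pres_eq X R (u @ r @ v) (u @ v)"

definition pres_class :: "'x set \<Rightarrow> 'x word set \<Rightarrow> 'x word \<Rightarrow> 'x word set" where
  "pres_class X R w = {v. pres_eq X R w v}"

definition presented_group :: "'x set \<Rightarrow> 'x word set \<Rightarrow> 'x word set monoid" where
  "presented_group X R =
    \<lparr>carrier = pres_class X R ` words X,
     mult = (\<lambda>A B. {w. \<exists>u\<in>A. \<exists>v\<in>B. pres_eq X R (u @ v) w}),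
     one = pres_class X R []\<rparr>"

fun word_eval :: "('a, 'b) monoid_scheme \<Rightarrow> ('x \<Rightarrow> 'a) \<Rightarrow> 'x word \<Rightarrow> 'a" where
  "word_eval G f [] = \<one>\<^bsub>G\<^esub>"
| "word_eval G f ((x, e) # w) = (if e then f x else inv\<^bsub>G\<^esub> (f x)) \<otimes>\<^bsub>G\<^esub> word_eval G f w"

text \<open>The homomorphism out of a presented group that extends a map \<open>f\<close> on generators; the choice of
  the representative is immaterial if \<open>f\<close> kills the relators (lemma \<open>presented_lift_class\<close>).\<close>

definition presented_lift :: "('a, 'b) monoid_scheme \<Rightarrow> ('x \<Rightarrow> 'a) \<Rightarrow> 'x word set \<Rightarrow> 'a" where
  "presented_lift G f A = word_eval G f (SOME w. w \<in> A)"


section \<open>The weak commutativity construction\<close>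

text \<open>The generators \<open>Inl g\<close> and \<open>Inr g\<close> are the elements \<open>g\<close> of \<open>G\<close> and their copies in the isomorphic copy of \<open>G\<close>.
  The relators of the first two kinds are the multiplication tables of \<open>G\<close> and of its copy.\<close>

definition weak_comm_gens :: "('a, 'b) monoid_scheme \<Rightarrow> ('a + 'a) set" where
  "weak_comm_gens G = Inl ` carrier G \<union> Inr ` carrier G"

definition weak_comm_rels :: "('a, 'b) monoid_scheme \<Rightarrow> ('a + 'a) word set" where
  "weak_comm_rels G =
     {[(Inl g, True), (Inl h, True), (Inl (g \<otimes>\<^bsub>G\<^esub> h), False)] | g h. g \<in> carrier G \<and> h \<in> carrier G}
   \<union> {[(Inr g, True), (Inr h, True), (Inr (g \<otimes>\<^bsub>G\<^esub> h), False)] | g h. g \<in> carrier G \<and> h \<in> carrier G}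
   \<union> {[(Inl g, True), (Inr g, True), (Inl g, False), (Inr g, False)] | g. g \<in> carrier G}"

definition weak_comm :: "('a, 'b) monoid_scheme \<Rightarrow> ('a + 'a) word set monoid" where
  "weak_comm G = presented_group (weak_comm_gens G) (weak_comm_rels G)"

definition weak_comm_gen :: "('a, 'b) monoid_scheme \<Rightarrow> 'a + 'a \<Rightarrow> ('a + 'a) word set" where
  "weak_comm_gen G x = pres_class (weak_comm_gens G) (weak_comm_rels G) [(x, True)]"

definition pi1 :: "('a, 'b) monoid_scheme \<Rightarrow> ('a + 'a) word set \<Rightarrow> 'a" where
  "pi1 G = presented_lift G (case_sum (\<lambda>g. g) (\<lambda>g. \<one>\<^bsub>G\<^esub>))"

definition pi2 :: "('a, 'b) monoid_scheme \<Rightarrow> ('a + 'a) word set \<Rightarrow> 'a" where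
  "pi2 G = presented_lift G (case_sum (\<lambda>g. \<one>\<^bsub>G\<^esub>) (\<lambda>g. g))"

definition pi3 :: "('a, 'b) monoid_scheme \<Rightarrow> ('a + 'a) word set \<Rightarrow> 'a" where
  "pi3 G = presented_lift G (case_sum (\<lambda>g. g) (\<lambda>g. g))"

definition fg_subgroup :: "('a, 'b) monoid_scheme \<Rightarrow> 'a set \<Rightarrow> bool" where
  "fg_subgroup G H \<longleftrightarrow> subgroup H G \<and> (\<exists>S. finite S \<and> S \<subseteq> H \<and> H = generate G S)"


section \<open>The construction yields a group and the projections are epimorphisms\<close>

lemma words_append [simp]: "u @ v \<in> words X \<longleftrightarrow> u \<in> words X \<and> v \<in> words X"
  by (auto simp: words_def)

lemma words_Nil [simp]: "[] \<in> words X"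
  by (simp add: words_def)

lemma words_Cons [simp]: "(x, e) # w \<in> words X \<longleftrightarrow> x \<in> X \<and> w \<in> words X"
  by (auto simp: words_def)

lemma word_inv_Nil [simp]: "word_inv [] = []"
  by (simp add: word_inv_def)

lemma word_inv_Cons [simp]: "word_inv ((x, e) # w) = word_inv w @ [(x, \<not> e)]"
  by (simp add: word_inv_def)

lemma word_inv_words: "w \<in> words X \<Longrightarrow> word_inv w \<in> words X"
  by (induction w) auto

lemma pres_eq_words: "pres_eq X R u v \<Longrightarrow> u \<in> words X \<and> v \<in> words X"
  by (induction rule: pres_eq.induct) auto

lemma pres_eq_ctxt:
  "pres_eq X R u v \<Longrightarrow> p \<in> words X \<Longrightarrow> q \<in> words X \<Longrightarrow> pres_eq X R (p @ u @ q) (p @ v @ q)"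
proof (induction rule: pres_eq.induct)
  case (cancel u v x e)
  then show ?case using pres_eq.cancel[of "p @ u" X "v @ q" x R e] by simp
next
  case (relator u v r)
  then show ?case using pres_eq.relator[of "p @ u" X "v @ q" r R] by simp
qed (auto intro: pres_eq.refl pres_eq.sym pres_eq.trans)

lemma pres_eq_append:
  assumes "pres_eq X R u u'" "pres_eq X R v v'"
  shows "pres_eq X R (u @ v) (u' @ v')"
  using pres_eq_ctxt[OF assms(1), of "[]" v] pres_eq_ctxt[OF assms(2), of u' "[]"]
    pres_eq_words[OF assms(1)] pres_eq_words[OF assms(2)] by (auto intro: pres_eq.trans)

lemma pres_eq_word_inv: "w \<in> words X \<Longrightarrow> pres_eq X R (word_inv w @ w) []"
proof (induction w)
  case (Cons a w)
  obtain x e where a: "a = (x, e)" by (cases a)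
  have "pres_eq X R (word_inv w @ [(x, \<not> e), (x, \<not> \<not> e)] @ w) (word_inv w @ w)"
    using Cons a by (intro pres_eq.cancel) (auto intro: word_inv_words)
  with Cons a show ?case by (auto intro: pres_eq.trans)
qed (simp add: pres_eq.refl)

lemma pres_class_eq_iff:
  "u \<in> words X \<Longrightarrow> pres_class X R u = pres_class X R v \<longleftrightarrow> pres_eq X R u v"
  unfolding pres_class_def by (blast intro: pres_eq.intros(1-3) dest: pres_eq_words)

lemma presented_group_mult:
  "u \<in> words X \<Longrightarrow> v \<in> words X \<Longrightarrow>
    pres_class X R u \<otimes>\<^bsub>presented_group X R\<^esub> pres_class X R v = pres_class X R (u @ v)"
  unfolding presented_group_def pres_class_def
  by (auto intro: pres_eq.intros(1-3) pres_eq_append)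

lemma presented_group_carrier: "carrier (presented_group X R) = pres_class X R ` words X"
  by (simp add: presented_group_def)

lemma presented_group_one: "\<one>\<^bsub>presented_group X R\<^esub> = pres_class X R []"
  by (simp add: presented_group_def)

lemma group_presented_group: "group (presented_group X R)"
proof (rule groupI)
  fix A assume "A \<in> carrier (presented_group X R)"
  then obtain w where w: "w \<in> words X" "A = pres_class X R w"
    by (auto simp: presented_group_carrier)
  then show "\<exists>B\<in>carrier (presented_group X R). B \<otimes>\<^bsub>presented_group X R\<^esub> A = \<one>\<^bsub>presented_group X R\<^esub>"
    by (intro bexI[of _ "pres_class X R (word_inv w)"])
      (auto simp: presented_group_mult presented_group_one presented_group_carrier
        pres_class_eq_iff word_inv_words pres_eq_word_inv)
qed (auto simp: presented_group_carrier presented_group_one presented_group_mult)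

context group
begin

lemma word_eval_closed:
  "f ` X \<subseteq> carrier G \<Longrightarrow> w \<in> words X \<Longrightarrow> word_eval G f w \<in> carrier G"
  by (induction w) (auto simp: image_subset_iff)

lemma word_eval_append:
  "f ` X \<subseteq> carrier G \<Longrightarrow> u \<in> words X \<Longrightarrow> v \<in> words X \<Longrightarrow>
    word_eval G f (u @ v) = word_eval G f u \<otimes> word_eval G f v"
  by (induction u) (auto simp: word_eval_closed m_assoc image_subset_iff)

lemma word_eval_pres_eq:
  assumes "f ` X \<subseteq> carrier G" "\<And>r. r \<in> R \<Longrightarrow> word_eval G f r = \<one>"
  shows "pres_eq X R u v \<Longrightarrow> word_eval G f u = word_eval G f v"
proof (induction rule: pres_eq.induct)
  case (cancel u v x e)
  then have "f x \<in> carrier G" "word_eval G f v \<in> carrier G"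
    using assms(1) word_eval_closed by auto
  then have "word_eval G f ([(x, e), (x, \<not> e)] @ v) = word_eval G f v"
    by (auto simp: m_assoc[symmetric])
  moreover have "[(x, e), (x, \<not> e)] @ v \<in> words X" using cancel by simp
  ultimately show ?case
    using cancel word_eval_append[OF assms(1)] by metis
next
  case (relator u v r)
  then show ?case
    using assms word_eval_closed[OF assms(1)]
    by (simp add: word_eval_append[OF assms(1)])
qed auto

lemma presented_lift_class:
  assumes "f ` X \<subseteq> carrier G" "\<And>r. r \<in> R \<Longrightarrow> word_eval G f r = \<one>" "w \<in> words X"
  shows "presented_lift G f (pres_class X R w) = word_eval G f w"
proof -
  have "w \<in> pres_class X R w" using assms(3) by (simp add: pres_class_def pres_eq.refl)
  then have "(SOME v. v \<in> pres_class X R w) \<in> pres_class X R w" by (rule someI)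
  then have "pres_eq X R w (SOME v. v \<in> pres_class X R w)"
    by (simp add: pres_class_def)
  from word_eval_pres_eq[OF assms(1,2) this] show ?thesis
    by (simp add: presented_lift_def)
qed

lemma presented_lift_hom:
  assumes "f ` X \<subseteq> carrier G" "\<And>r. r \<in> R \<Longrightarrow> word_eval G f r = \<one>"
  shows "presented_lift G f \<in> hom (presented_group X R) G"
  by (rule homI)
    (auto simp: presented_group_carrier presented_group_mult presented_lift_class[OF assms]
      word_eval_closed[OF assms(1)] word_eval_append[OF assms(1)])

lemma weak_comm_is_group: "group (weak_comm G)"
  by (simp add: weak_comm_def group_presented_group)

lemma weak_comm_lift:
  assumes "f ` weak_comm_gens G \<subseteq> carrier G" "\<And>r. r \<in> weak_comm_rels G \<Longrightarrow> word_eval G f r = \<one>"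
  shows "presented_lift G f \<in> hom (weak_comm G) G"
    and "x \<in> weak_comm_gens G \<Longrightarrow> presented_lift G f (weak_comm_gen G x) = f x"
  using assms presented_lift_hom[OF assms] presented_lift_class[OF assms, where w = "[(x, True)]"]
  by (auto simp: weak_comm_def weak_comm_gen_def image_subset_iff)

lemma pi_maps_kill_rels:
  assumes "r \<in> weak_comm_rels G"
  shows "word_eval G (case_sum (\<lambda>g. g) (\<lambda>g. \<one>)) r = \<one>"
    and "word_eval G (case_sum (\<lambda>g. \<one>) (\<lambda>g. g)) r = \<one>"
    and "word_eval G (case_sum (\<lambda>g. g) (\<lambda>g. g)) r = \<one>"
  using assms by (auto simp: weak_comm_rels_def m_assoc[symmetric])

lemma pi1_props:
  shows "pi1 G \<in> hom (weak_comm G) G"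
    and "g \<in> carrier G \<Longrightarrow> pi1 G (weak_comm_gen G (Inl g)) = g"
    and "g \<in> carrier G \<Longrightarrow> pi1 G (weak_comm_gen G (Inr g)) = \<one>"
  unfolding pi1_def
  by (subst weak_comm_lift pi_maps_kill_rels | auto simp: weak_comm_gens_def intro!: weak_comm_lift pi_maps_kill_rels)+

lemma pi2_props:
  shows "pi2 G \<in> hom (weak_comm G) G"
    and "g \<in> carrier G \<Longrightarrow> pi2 G (weak_comm_gen G (Inl g)) = \<one>"
    and "g \<in> carrier G \<Longrightarrow> pi2 G (weak_comm_gen G (Inr g)) = g"
  unfolding pi2_def
  by (subst weak_comm_lift pi_maps_kill_rels | auto simp: weak_comm_gens_def intro!: weak_comm_lift pi_maps_kill_rels)+

lemma pi3_props:
  shows "pi3 G \<in> hom (weak_comm G) G"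
    and "g \<in> carrier G \<Longrightarrow> pi3 G (weak_comm_gen G (Inl g)) = g"
    and "g \<in> carrier G \<Longrightarrow> pi3 G (weak_comm_gen G (Inr g)) = g"
  unfolding pi3_def
  by (subst weak_comm_lift pi_maps_kill_rels | auto simp: weak_comm_gens_def intro!: weak_comm_lift pi_maps_kill_rels)+

lemma weak_comm_gen_closed:
  "g \<in> carrier G \<Longrightarrow> weak_comm_gen G (Inl g) \<in> carrier (weak_comm G)"
  "g \<in> carrier G \<Longrightarrow> weak_comm_gen G (Inr g) \<in> carrier (weak_comm G)"
  by (auto simp: weak_comm_def weak_comm_gen_def presented_group_carrier weak_comm_gens_def)

lemma pi_epi:
  "pi1 G \<in> epi (weak_comm G) G" "pi2 G \<in> epi (weak_comm G) G" "pi3 G \<in> epi (weak_comm G) G"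
  unfolding epi_def
  using pi1_props pi2_props pi3_props weak_comm_gen_closed
  by (auto simp: hom_def Pi_iff image_iff) metis+

end

end

theory Submission
  imports Defs
begin

text \<open>
  Write \<open>\<X>\<close> for \<open>\<X>(G)\<close> and \<open>\<iota>, \<kappa> : G \<rightarrow> \<X>\<close> for the inclusions of \<open>G\<close> and of its copy. Two normal
  subgroups matter: \<open>L = ker \<pi>\<^sub>3\<close>, generated by the elements \<open>\<ell>(g) = \<iota>(g) \<kappa>(g)\<^sup>-\<^sup>1\<close>, and
  \<open>D = ker \<pi>\<^sub>1 \<inter> ker \<pi>\<^sub>2\<close>, generated by the mixed commutators \<open>[\<iota>(a), \<kappa>(b)]\<close>. They commute
  elementwise (\<open>L_D_commute\<close>).

  Images of finitely generated groups are finitely generated, so let the three projections of \<open>N\<close> be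
  finitely generated. As \<open>N\<close> contains \<open>\<X>'\<close>, it can be reached from the finitely generated group \<open>\<X>\<close>
  through finitely many subgroups, each of which is of the form \<open>\<langle>P, x\<rangle>\<close> for the next one \<open>P\<close> and a
  single \<open>x\<close>. If \<open>\<langle>P, x\<rangle>\<close> is finitely generated, then \<open>P\<close> has a finite subset \<open>P\<^sub>0\<close> such that \<open>P\<close> is
  the only subgroup of \<open>P\<close> that contains \<open>P\<^sub>0\<close> and is normalized by \<open>x\<close> (\<open>fg_cyclic_extension\<close>).
  Hence it suffices to enlarge \<open>P\<^sub>0\<close> to a finite subset of \<open>P\<close> that generates a subgroup normalized
  by \<open>x\<close>. This is done in two stages.

  From \<open>\<X>\<close> down to \<open>\<pi>\<^sub>3\<^sup>-\<^sup>1(\<pi>\<^sub>3(N))\<close> (\<open>fg_preimage\<close>): let \<open>P = \<pi>\<^sub>3\<^sup>-\<^sup>1(M)\<close> with \<open>M \<supseteq> G'\<close> finitely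
  generated, and let \<open>x = \<iota>(t)\<close>. Then \<open>P\<close> is generated by \<open>\<iota>(M)\<close> and \<open>L\<close>, so \<open>P\<^sub>0\<close> involves only
  finitely many \<open>\<ell>(y)\<close>. The group generated by \<open>\<iota>(M)\<close>, \<open>\<kappa>(M)\<close>, \<open>\<ell>(t)\<close> and all \<open>\<ell>(y)\<close>, \<open>\<ell>(t y)\<close> is
  normalized by \<open>\<iota>(t)\<close>, because \<open>\<iota>(t) \<ell>(y) \<iota>(t)\<^sup>-\<^sup>1 = \<ell>(t y) \<ell>(t)\<^sup>-\<^sup>1\<close> and
  \<open>\<ell>(g t\<^sup>-\<^sup>1) = \<ell>(g) \<ell>(g t)\<^sup>-\<^sup>1 \<ell>(g)\<close>: modulo \<open>\<iota>(M)\<close> and \<open>\<kappa>(M)\<close>, two consecutive terms of the sequence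
  \<open>\<ell>(t\<^sup>k y)\<close> determine the next one in either direction.

  From \<open>\<pi>\<^sub>3\<^sup>-\<^sup>1(\<pi>\<^sub>3(N)) = N L\<close> down to \<open>N\<close> (\<open>fg_subgroup_kernel_step\<close>): now \<open>x = l\<close> lies in \<open>L\<close>, and
  \<open>\<pi>\<^sub>1(P)\<close> and \<open>\<pi>\<^sub>2(P)\<close> are finitely generated. Modulo \<open>D\<close> everything takes place in \<open>G \<times> G\<close>, where it
  is enough to add to generators \<open>a\<close> of \<open>\<pi>\<^sub>i(P)\<close> the elements \<open>a\<^sup>-\<^sup>1 (u a u\<^sup>-\<^sup>1)\<close>, \<open>u = \<pi>\<^sub>i(l)\<close>, of the
  \<open>i\<close>-th factor (\<open>fg_modulo_D\<close>). The finitely many errors in \<open>D\<close> are added as well; they cause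
  no further errors, since \<open>l\<close> centralizes \<open>D\<close>.

  The statement on \<open>\<X>'\<close> is the case \<open>N = \<X>'\<close>, as each projection maps \<open>\<X>'\<close> onto \<open>G'\<close>.
\<close>

section \<open>Conjugation, cyclic extensions and finite generation\<close>

text \<open>Conjugation from the left, \<open>y \<mapsto> x y x\<^sup>-\<^sup>1\<close>.\<close>

definition conj_by :: "('a, 'b) monoid_scheme \<Rightarrow> 'a \<Rightarrow> 'a \<Rightarrow> 'a" where
  "conj_by G x y = x \<otimes>\<^bsub>G\<^esub> y \<otimes>\<^bsub>G\<^esub> inv\<^bsub>G\<^esub> x"

text \<open>\<open>x R x\<^sup>-\<^sup>1 = R\<close>, as closure under conjugation by \<open>x\<close> and by \<open>x\<^sup>-\<^sup>1\<close>. Closure under conjugation by \<open>x\<close> alone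
  would be weaker: \<open>x\<close> may conjugate an infinite subgroup into a proper subgroup of itself.\<close>

definition normalizes :: "('a, 'b) monoid_scheme \<Rightarrow> 'a \<Rightarrow> 'a set \<Rightarrow> bool" where
  "normalizes G x R \<longleftrightarrow> (\<forall>r\<in>R. conj_by G x r \<in> R \<and> conj_by G (inv\<^bsub>G\<^esub> x) r \<in> R)"

context group
begin

lemma inv_mult_cancel:
  "x \<in> carrier G \<Longrightarrow> y \<in> carrier G \<Longrightarrow> inv x \<otimes> (x \<otimes> y) = y"
  "x \<in> carrier G \<Longrightarrow> y \<in> carrier G \<Longrightarrow> x \<otimes> (inv x \<otimes> y) = y"
  by (simp_all add: m_assoc[symmetric])

lemmas word_simps = m_assoc inv_mult_group inv_mult_cancel

lemma conj_by_closed [simp]: "x \<in> carrier G \<Longrightarrow> y \<in> carrier G \<Longrightarrow> conj_by G x y \<in> carrier G"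
  by (simp add: conj_by_def)

lemma conj_by_one [simp]: "x \<in> carrier G \<Longrightarrow> conj_by G x \<one> = \<one>"
  by (simp add: conj_by_def)

lemma conj_by_mult:
  "x \<in> carrier G \<Longrightarrow> y \<in> carrier G \<Longrightarrow> z \<in> carrier G \<Longrightarrow>
    conj_by G x (y \<otimes> z) = conj_by G x y \<otimes> conj_by G x z"
  by (simp add: conj_by_def word_simps)

lemma conj_by_inv:
  "x \<in> carrier G \<Longrightarrow> y \<in> carrier G \<Longrightarrow> conj_by G x (inv y) = inv (conj_by G x y)"
  by (simp add: conj_by_def word_simps)

lemma conj_by_conj_by:
  "x \<in> carrier G \<Longrightarrow> y \<in> carrier G \<Longrightarrow> z \<in> carrier G \<Longrightarrow>
    conj_by G x (conj_by G y z) = conj_by G (x \<otimes> y) z"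
  by (simp add: conj_by_def word_simps)

lemma conj_by_by_one [simp]: "y \<in> carrier G \<Longrightarrow> conj_by G \<one> y = y"
  by (simp add: conj_by_def)

lemma conj_by_generate:
  assumes "x \<in> carrier G" "S \<subseteq> carrier G" "subgroup R G"
    and "\<And>s. s \<in> S \<Longrightarrow> conj_by G x s \<in> R" "r \<in> generate G S"
  shows "conj_by G x r \<in> R"
  using assms(5)
proof (induction rule: generate.induct)
  case one
  then show ?case using assms by (simp add: subgroup.one_closed)
next
  case (incl h)
  then show ?case using assms by simp
next
  case (inv h)
  then have "conj_by G x (inv h) = inv (conj_by G x h)"
    using assms by (intro conj_by_inv) auto
  then show ?case using assms inv by (simp add: subgroup.m_inv_closed)
next
  case (eng h1 h2)
  then have "conj_by G x (h1 \<otimes> h2) = conj_by G x h1 \<otimes> conj_by G x h2"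
    using assms generate_in_carrier by (intro conj_by_mult) auto
  then show ?case using eng assms(3) by (simp add: subgroup.m_closed)
qed

lemma normalizes_generate:
  assumes "x \<in> carrier G" "S \<subseteq> carrier G"
    and "\<And>s. s \<in> S \<Longrightarrow> conj_by G x s \<in> generate G S"
    and "\<And>s. s \<in> S \<Longrightarrow> conj_by G (inv x) s \<in> generate G S"
  shows "normalizes G x (generate G S)"
  unfolding normalizes_def
  using conj_by_generate[OF _ assms(2) generate_is_subgroup[OF assms(2)]] assms by simp

lemma normalizes_inv: "x \<in> carrier G \<Longrightarrow> normalizes G x R \<Longrightarrow> normalizes G (inv x) R"
  by (simp add: normalizes_def)

lemma normalizes_int_pow:
  assumes "x \<in> carrier G" "subgroup R G" "normalizes G x R" "r \<in> R"
  shows "conj_by G (x [^] (k::int)) r \<in> R"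
proof -
  have nat: "conj_by G (y [^] n) r \<in> R"
    if "y \<in> carrier G" "normalizes G y R" for y and n :: nat
  proof (induction n)
    case 0
    then show ?case using assms that subgroup.mem_carrier[OF assms(2)] by simp
  next
    case (Suc n)
    have "conj_by G (y [^] Suc n) r = conj_by G y (conj_by G (y [^] n) r)"
      using that assms subgroup.mem_carrier[OF assms(2)]
      by (simp only: nat_pow_Suc2) (simp add: conj_by_conj_by del: nat_pow_Suc)
    then show ?case using Suc that by (simp add: normalizes_def)
  qed
  show ?thesis
  proof (cases k rule: int_cases2)
    case (nonneg n)
    then show ?thesis using nat[of x n] assms by (simp add: int_pow_int)
  next
    case (nonpos n)
    then have "x [^] k = inv x [^] n"
      using assms(1) by (simp add: int_pow_neg_int nat_pow_inv)
    then show ?thesis using nat[OF _ normalizes_inv[OF assms(1,3)]] assms(1) by simp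
  qed
qed

text \<open>The extension of a subgroup \<open>R\<close> by an element that normalizes it consists of the products of
  an element of \<open>R\<close> and a power.\<close>

lemma generate_insert_normalizing:
  assumes "x \<in> carrier G" "subgroup R G" "normalizes G x R" "y \<in> generate G (insert x R)"
  shows "\<exists>r\<in>R. \<exists>k::int. y = r \<otimes> x [^] k"
  using assms(4)
proof (induction rule: generate.induct)
  case one
  then show ?case using subgroup.one_closed[OF assms(2)]
    by (intro bexI[of _ \<one>] exI[of _ 0]) auto
next
  case (incl h)
  then consider "h = x" | "h \<in> R" by auto
  then show ?case
  proof cases
    case 1
    then show ?thesis using subgroup.one_closed[OF assms(2)] assms(1)
      by (intro bexI[of _ \<one>] exI[of _ 1]) (auto simp: int_pow_1)
  next
    case 2
    then show ?thesis using subgroup.mem_carrier[OF assms(2)]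
      by (intro bexI[of _ h] exI[of _ 0]) auto
  qed
next
  case (inv h)
  then consider "h = x" | "h \<in> R" by auto
  then show ?case
  proof cases
    case 1
    then show ?thesis using subgroup.one_closed[OF assms(2)] assms(1)
      by (intro bexI[of _ \<one>] exI[of _ "-1"]) (auto simp: int_pow_neg int_pow_1)
  next
    case 2
    then show ?thesis using subgroup.mem_carrier[OF assms(2)] subgroup.m_inv_closed[OF assms(2)]
      by (intro bexI[of _ "inv h"] exI[of _ 0]) auto
  qed
next
  case (eng h1 h2)
  then obtain r1 k1 r2 k2 where h: "r1 \<in> R" "h1 = r1 \<otimes> x [^] (k1::int)"
      "r2 \<in> R" "h2 = r2 \<otimes> x [^] (k2::int)" by blast
  have c: "r1 \<in> carrier G" "r2 \<in> carrier G" using h subgroup.mem_carrier[OF assms(2)] by auto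
  let ?s = "conj_by G (x [^] k1) r2"
  have "?s \<in> R" using normalizes_int_pow assms h by blast
  moreover have "h1 \<otimes> h2 = (r1 \<otimes> ?s) \<otimes> x [^] (k1 + k2)"
    using assms(1) h c by (simp add: conj_by_def word_simps int_pow_mult)
  ultimately show ?case using h subgroup.m_closed[OF assms(2)] by metis
qed

text \<open>A subgroup of a cyclic group is cyclic.\<close>

lemma powers_in_subgroup_cyclic:
  assumes "x \<in> carrier G" "subgroup P G"
  obtains n :: int where "x [^] n \<in> P" "\<And>k::int. x [^] k \<in> P \<Longrightarrow> n dvd k"
proof (cases "\<exists>n::nat. n > 0 \<and> x [^] (int n) \<in> P")
  case True
  define n where "n = (LEAST n::nat. n > 0 \<and> x [^] (int n) \<in> P)"
  have n: "n > 0" "x [^] (int n) \<in> P"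
    using LeastI_ex[OF True] unfolding n_def by auto
  have "int n dvd k" if k: "x [^] k \<in> P" for k :: int
  proof (rule ccontr)
    assume nd: "\<not> int n dvd k"
    define m where "m = nat (k mod int n)"
    have m: "int m = k mod int n" using n by (simp add: m_def)
    have "0 \<le> k mod int n" "k mod int n < int n" "k mod int n \<noteq> 0"
      using n nd by (simp_all add: dvd_eq_mod_eq_0)
    then have "m > 0" "m < n" using m by linarith+
    have "int m = k + int n * (- (k div int n))"
      unfolding m by (simp add: minus_mult_div_eq_mod[symmetric])
    then have "x [^] int m = x [^] k \<otimes> (x [^] int n) [^] (- (k div int n))"
      using assms(1) by (simp only: int_pow_mult int_pow_pow)
    also have "\<dots> \<in> P"
      using k n subgroup_int_pow_closed[OF assms(2)] subgroup.m_closed[OF assms(2)] by blast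
    finally have "n \<le> m" unfolding n_def using \<open>m > 0\<close> by (intro Least_le) auto
    with \<open>m < n\<close> show False by simp
  qed
  with n that show ?thesis by blast
next
  case False
  have "k = 0" if k: "x [^] k \<in> P" for k :: int
  proof (rule ccontr)
    assume "k \<noteq> 0"
    have "x [^] (- k) \<in> P" using k assms by (simp add: int_pow_neg subgroup.m_inv_closed)
    then have "x [^] int (nat \<bar>k\<bar>) \<in> P" using k by (simp add: abs_if)
    moreover have "nat \<bar>k\<bar> > 0" using \<open>k \<noteq> 0\<close> by simp
    ultimately show False using False by blast
  qed
  then show ?thesis using that[of 0] subgroup.one_closed[OF assms(2)] by auto
qed

text \<open>If \<open>\<langle>P, x\<rangle>\<close> is finitely generated, then \<open>P\<close> is finitely generated as a group on which \<open>x\<close> acts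
  by conjugation. The set \<open>P\<^sub>0\<close> consists of the \<open>P\<close>-parts of finitely many generators \<open>p x\<^sup>k\<close> of
  \<open>\<langle>P, x\<rangle>\<close> and of a generator of \<open>P \<inter> \<langle>x\<rangle>\<close>, which is needed when some power of \<open>x\<close> lies in \<open>P\<close>.\<close>

lemma fg_cyclic_extension:
  assumes "subgroup P G" "x \<in> carrier G" "normalizes G x P"
    and "fg_subgroup G (generate G (insert x P))"
  obtains P0 where "finite P0" "P0 \<subseteq> P"
    "\<And>R. subgroup R G \<Longrightarrow> R \<subseteq> P \<Longrightarrow> P0 \<subseteq> R \<Longrightarrow> normalizes G x R \<Longrightarrow> P \<subseteq> R"
proof -
  obtain S where S: "finite S" "S \<subseteq> generate G (insert x P)"
      "generate G (insert x P) = generate G S"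
    using assms(4) unfolding fg_subgroup_def by blast
  have "\<forall>s\<in>S. \<exists>p. p \<in> P \<and> (\<exists>k::int. s = p \<otimes> x [^] k)"
    using generate_insert_normalizing[OF assms(2,1,3)] S(2) by blast
  from bchoice[OF this] obtain p
    where p: "\<And>s. s \<in> S \<Longrightarrow> p s \<in> P \<and> (\<exists>k::int. s = p s \<otimes> x [^] k)" by blast
  obtain n :: int where n: "x [^] n \<in> P" "\<And>k::int. x [^] k \<in> P \<Longrightarrow> n dvd k"
    using powers_in_subgroup_cyclic[OF assms(2,1)] by blast
  show ?thesis
  proof (rule that[of "insert (x [^] n) (p ` S)"])
    show "finite (insert (x [^] n) (p ` S))" using S by simp
    show "insert (x [^] n) (p ` S) \<subseteq> P" using n p by blast
  next
    fix R assume R: "subgroup R G" "R \<subseteq> P" "insert (x [^] n) (p ` S) \<subseteq> R" "normalizes G x R"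
    have sub: "insert x R \<subseteq> carrier G" using assms(2) subgroup.subset[OF R(1)] by blast
    note gen = generate_is_subgroup[OF sub]
    have "S \<subseteq> generate G (insert x R)"
    proof
      fix s assume s: "s \<in> S"
      then obtain k :: int where k: "s = p s \<otimes> x [^] k" using p by blast
      have "p s \<in> generate G (insert x R)" using R s by (intro generate.incl) blast
      moreover have "x [^] k \<in> generate G (insert x R)"
        using subgroup_int_pow_closed[OF gen] by (simp add: generate.incl)
      ultimately show "s \<in> generate G (insert x R)" using k generate.eng by metis
    qed
    then have incl: "generate G S \<subseteq> generate G (insert x R)"
      using generate_subgroup_incl[OF _ gen] by blast
    show "P \<subseteq> R"
    proof
      fix q assume q: "q \<in> P"
      then have "q \<in> generate G (insert x R)"
        using incl S(3) generate.incl[of q "insert x P" G] by blast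
      then obtain r and k :: int where r: "r \<in> R" "q = r \<otimes> x [^] k"
        using generate_insert_normalizing[OF assms(2) R(1,4)] by blast
      have qc: "q \<in> carrier G" "r \<in> carrier G"
        using q r(1) subgroup.mem_carrier[OF assms(1)] subgroup.mem_carrier[OF R(1)] by auto
      have "x [^] k = inv r \<otimes> q" using r(2) qc assms(2) by (simp add: inv_mult_cancel)
      also have "\<dots> \<in> P"
        using q r(1) R(2) assms(1) by (meson subgroup.m_closed subgroup.m_inv_closed subsetD)
      finally obtain j where "k = n * j" using n(2) by (auto elim: dvdE)
      then have "x [^] k = (x [^] n) [^] j" using assms(2) by (simp only: int_pow_pow)
      also have "\<dots> \<in> R" using R subgroup_int_pow_closed[OF R(1)] by blast
      finally show "q \<in> R" using r R(1) subgroup.m_closed by metis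
    qed
  qed
qed

lemma fg_subgroup_generate:
  "finite S \<Longrightarrow> S \<subseteq> carrier G \<Longrightarrow> fg_subgroup G (generate G S)"
  unfolding fg_subgroup_def
  by (intro conjI generate_is_subgroup exI[of _ S]) (auto intro: generate.incl)

lemma fg_subgroupE:
  assumes "fg_subgroup G H"
  obtains S where "finite S" "S \<subseteq> H" "S \<subseteq> carrier G" "H = generate G S" "subgroup H G"
proof -
  obtain S where S: "finite S" "S \<subseteq> H" "H = generate G S" and H: "subgroup H G"
    using assms unfolding fg_subgroup_def by blast
  then show ?thesis using that[of S] subgroup.subset[OF H] by simp
qed

lemma subset_generate: "S \<subseteq> generate G S"
  by (auto intro: generate.incl)

lemma generate_Un_generate:
  assumes "S \<subseteq> carrier G" "T \<subseteq> carrier G"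
  shows "generate G (generate G S \<union> T) = generate G (S \<union> T)"
proof
  have sub: "subgroup (generate G (S \<union> T)) G" using assms by (intro generate_is_subgroup) auto
  have "generate G S \<subseteq> generate G (S \<union> T)" by (intro mono_generate) auto
  moreover have "T \<subseteq> generate G (S \<union> T)" by (auto intro: generate.incl)
  ultimately show "generate G (generate G S \<union> T) \<subseteq> generate G (S \<union> T)"
    by (intro generate_subgroup_incl[OF _ sub]) auto
  show "generate G (S \<union> T) \<subseteq> generate G (generate G S \<union> T)"
    using subset_generate by (intro mono_generate) auto
qed

lemma fg_subgroup_insert:
  assumes "fg_subgroup G H" "x \<in> carrier G"
  shows "fg_subgroup G (generate G (insert x H))"
proof -
  obtain S where S: "finite S" "S \<subseteq> carrier G" "H = generate G S"
    using fg_subgroupE[OF assms(1)] by metis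
  have "generate G (insert x H) = generate G (S \<union> {x})"
    using generate_Un_generate[of S "{x}"] S assms(2) by simp
  then show ?thesis using fg_subgroup_generate[of "S \<union> {x}"] S assms(2) by simp
qed

text \<open>A finite part of \<open>\<langle>f(A) \<union> B\<rangle>\<close> involves only finitely many elements of \<open>A\<close>; all of \<open>B\<close> is kept.\<close>

lemma finite_subset_generate:
  assumes "finite F" "F \<subseteq> generate G (f ` A \<union> B)"
  obtains Y where "finite Y" "Y \<subseteq> A" "F \<subseteq> generate G (f ` Y \<union> B)"
proof -
  have one: "\<exists>Y. finite Y \<and> Y \<subseteq> A \<and> x \<in> generate G (f ` Y \<union> B)"
    if "x \<in> generate G (f ` A \<union> B)" for x
    using that
  proof (induction rule: generate.induct)
    case one
    then show ?case using generate.one by blast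
  next
    case (incl h)
    then consider "h \<in> B" | a where "a \<in> A" "h = f a" by blast
    then show ?case
    proof cases
      case 1
      then show ?thesis by (intro exI[of _ "{}"]) (auto intro: generate.incl)
    next
      case 2
      then show ?thesis by (intro exI[of _ "{a}"]) (auto intro: generate.incl)
    qed
  next
    case (inv h)
    then consider "h \<in> B" | a where "a \<in> A" "h = f a" by blast
    then show ?case
    proof cases
      case 1
      then show ?thesis by (intro exI[of _ "{}"]) (auto intro: generate.inv)
    next
      case 2
      then show ?thesis by (intro exI[of _ "{a}"]) (auto intro: generate.inv)
    qed
  next
    case (eng h1 h2)
    then obtain Y1 Y2 where Y: "finite Y1" "Y1 \<subseteq> A" "h1 \<in> generate G (f ` Y1 \<union> B)"
       "finite Y2" "Y2 \<subseteq> A" "h2 \<in> generate G (f ` Y2 \<union> B)" by blast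
    have "generate G (f ` Y1 \<union> B) \<subseteq> generate G (f ` (Y1 \<union> Y2) \<union> B)"
      "generate G (f ` Y2 \<union> B) \<subseteq> generate G (f ` (Y1 \<union> Y2) \<union> B)"
      by (intro mono_generate; auto)+
    then show ?case using Y by (intro exI[of _ "Y1 \<union> Y2"]) (auto intro: generate.eng)
  qed
  then have "\<forall>x\<in>F. \<exists>Y. finite Y \<and> Y \<subseteq> A \<and> x \<in> generate G (f ` Y \<union> B)"
    using assms(2) by blast
  from bchoice[OF this] obtain Y where
    Y: "\<And>x. x \<in> F \<Longrightarrow> finite (Y x) \<and> Y x \<subseteq> A \<and> x \<in> generate G (f ` Y x \<union> B)" by blast
  have "x \<in> generate G (f ` \<Union> (Y ` F) \<union> B)" if "x \<in> F" for x
    using Y[OF that] mono_generate[of "f ` Y x \<union> B" "f ` \<Union> (Y ` F) \<union> B"] that by blast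
  then show ?thesis using that[of "\<Union> (Y ` F)"] Y assms(1) by blast
qed

lemma generate_between:
  assumes "subgroup H G" "H = generate G S" "S \<subseteq> T" "T \<subseteq> H"
  shows "H = generate G T"
  using mono_generate[OF assms(3)] generate_subgroup_incl[OF assms(4,1)] assms(2) by simp

lemma generate_commute:
  assumes "A \<subseteq> carrier G" "B \<subseteq> carrier G"
    and "\<And>a b. a \<in> A \<Longrightarrow> b \<in> B \<Longrightarrow> a \<otimes> b = b \<otimes> a"
    and "x \<in> generate G A" "y \<in> generate G B"
  shows "x \<otimes> y = y \<otimes> x"
proof -
  have key: "u \<otimes> v = v \<otimes> u" if "C \<subseteq> carrier G" "v \<in> carrier G"
      "\<And>c. c \<in> C \<Longrightarrow> c \<otimes> v = v \<otimes> c" "u \<in> generate G C" for C u v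
    using that(4)
  proof (induction rule: generate.induct)
    case (inv h)
    then have "h \<in> carrier G" "h \<otimes> v = v \<otimes> h" using that by auto
    then have "inv h \<otimes> (h \<otimes> v) \<otimes> inv h = inv h \<otimes> (v \<otimes> h) \<otimes> inv h" by simp
    then show ?case using \<open>h \<in> carrier G\<close> that(2) by (simp add: word_simps)
  next
    case (eng h1 h2)
    have "h1 \<in> carrier G" "h2 \<in> carrier G"
      using eng generate_in_carrier[OF that(1)] by auto
    then show ?case using eng that(2) by (metis m_assoc)
  qed (use that in auto)
  have "b \<otimes> x = x \<otimes> b" if "b \<in> B" for b
  proof -
    have "x \<otimes> b = b \<otimes> x"
      using that assms(2,3) by (intro key[OF assms(1) _ _ assms(4)]) auto
    then show ?thesis by simp
  qed
  then show ?thesis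
    using key[of B x y] assms(2,5) generate_in_carrier[OF assms(1,4)] by simp
qed

lemma conj_by_mem:
  assumes "subgroup P G" "derived G (carrier G) \<subseteq> P" "x \<in> carrier G" "p \<in> P"
  shows "conj_by G x p \<in> P"
proof -
  have p: "p \<in> carrier G" using subgroup.mem_carrier[OF assms(1,4)] .
  then have "x \<otimes> p \<otimes> inv x \<otimes> inv p \<in> derived G (carrier G)"
    unfolding derived_def using assms(3) by (intro generate.incl) auto
  then have "x \<otimes> p \<otimes> inv x \<otimes> inv p \<otimes> p \<in> P"
    using assms(2,4) subgroup.m_closed[OF assms(1)] by auto
  then show ?thesis using p assms(3) by (simp add: conj_by_def word_simps)
qed

lemma normalizes_subgroup_derived:
  "subgroup P G \<Longrightarrow> derived G (carrier G) \<subseteq> P \<Longrightarrow> x \<in> carrier G \<Longrightarrow> normalizes G x P"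
  unfolding normalizes_def using conj_by_mem by simp

text \<open>The factor by which conjugation by \<open>u\<close> moves \<open>x\<close>: \<open>u x u\<^sup>-\<^sup>1 = x (displacement u x)\<close>.\<close>

definition displacement :: "'a \<Rightarrow> 'a \<Rightarrow> 'a" where
  "displacement u x = inv x \<otimes> conj_by G u x"

lemma displacement_closed [simp]:
  "u \<in> carrier G \<Longrightarrow> x \<in> carrier G \<Longrightarrow> displacement u x \<in> carrier G"
  by (simp add: displacement_def)

lemma displacement_one: "u \<in> carrier G \<Longrightarrow> displacement u \<one> = \<one>"
  by (simp add: displacement_def)

lemma displacement_inv:
  "u \<in> carrier G \<Longrightarrow> x \<in> carrier G \<Longrightarrow>
    displacement u (inv x) = x \<otimes> inv (displacement u x) \<otimes> inv x"
  by (simp add: displacement_def conj_by_def word_simps)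

lemma displacement_mult:
  "u \<in> carrier G \<Longrightarrow> x \<in> carrier G \<Longrightarrow> y \<in> carrier G \<Longrightarrow>
    displacement u (x \<otimes> y) = inv y \<otimes> displacement u x \<otimes> y \<otimes> displacement u y"
  by (simp add: displacement_def conj_by_def word_simps)

end

text \<open>Let \<open>R\<close> be a subgroup whose image under a homomorphism \<open>h\<close> is generated by \<open>h(A)\<close>. If the displacements of
  the generators \<open>h(a)\<close> lift to elements of \<open>R\<close> that a second homomorphism \<open>q'\<close> kills, then so do the
  displacements of all elements of \<open>h(R)\<close>: \<open>R \<inter> ker q'\<close> is normal in \<open>R\<close>, and \<open>displacement u\<close> is a
  crossed homomorphism.\<close>

lemma (in group_hom) displacement_transfer:
  assumes q': "group_hom G H' q'"
    and R: "subgroup R G" and A: "A \<subseteq> R" "h ` R = generate H (h ` A)"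
    and u: "u \<in> carrier H"
    and gens: "\<And>a. a \<in> A \<Longrightarrow> \<exists>r\<in>R. h r = H.displacement u (h a) \<and> q' r = \<one>\<^bsub>H'\<^esub>"
    and x: "x \<in> h ` R"
  shows "\<exists>r\<in>R. h r = H.displacement u x \<and> q' r = \<one>\<^bsub>H'\<^esub>"
proof -
  interpret q': group_hom G H' q' by (rule q')
  have Rc: "R \<subseteq> carrier G" by (rule subgroup.subset[OF R])
  from x show ?thesis
    unfolding A(2)
  proof (induction rule: generate.induct)
    case one
    then show ?case using subgroup.one_closed[OF R] u
      by (intro bexI[of _ "\<one>"]) (auto simp: H.displacement_one)
  next
    case (incl y)
    then show ?case using gens by blast
  next
    case (inv y)
    then obtain a r where a: "a \<in> A" "y = h a" "r \<in> R" "h r = H.displacement u y" "q' r = \<one>\<^bsub>H'\<^esub>"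
      using gens by blast
    have "a \<in> R" "a \<in> carrier G" "r \<in> carrier G" using a A(1) Rc by auto
    moreover from this have "a \<otimes> inv r \<otimes> inv a \<in> R"
      using a R by (simp add: subgroup.m_closed subgroup.m_inv_closed)
    ultimately show ?case
      using a u by (intro bexI[of _ "a \<otimes> inv r \<otimes> inv a"]) (simp_all add: H.displacement_inv)
  next
    case (eng y z)
    then obtain r s where r: "r \<in> R" "h r = H.displacement u y" "q' r = \<one>\<^bsub>H'\<^esub>"
        "s \<in> R" "h s = H.displacement u z" "q' s = \<one>\<^bsub>H'\<^esub>" by blast
    have "y \<in> h ` R" "z \<in> h ` R" using eng A(2) by auto
    then obtain b where b: "b \<in> R" "z = h b" by blast
    have yc: "y \<in> carrier H" using \<open>y \<in> h ` R\<close> Rc by auto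
    have "b \<in> carrier G" "r \<in> carrier G" "s \<in> carrier G" using b r Rc by auto
    moreover have "inv b \<otimes> r \<otimes> b \<otimes> s \<in> R"
      using b(1) r(1,4) R by (simp add: subgroup.m_closed subgroup.m_inv_closed)
    ultimately show ?case
      using r b u yc by (intro bexI[of _ "inv b \<otimes> r \<otimes> b \<otimes> s"]) (simp_all add: H.displacement_mult)
  qed
qed

section \<open>Two weakly commuting copies of a group\<close>

text \<open>The situation of \<open>\<X>(G)\<close>, axiomatically: a group generated by two homomorphic images \<open>\<iota>(G)\<close> and \<open>\<kappa>(G)\<close> in
  which corresponding elements commute, with the three projections to \<open>G\<close>. That the defining relations
  are complete is not assumed; all that matters of it is that the projections exist.\<close>

locale weak_commutativity = X?: group X + G: group G
  for X (structure) and G (structure) +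
  fixes \<iota> \<kappa> :: "'c \<Rightarrow> 'a" and p1 p2 p3 :: "'a \<Rightarrow> 'c"
  assumes homs: "\<iota> \<in> hom G X" "\<kappa> \<in> hom G X" "p1 \<in> hom X G" "p2 \<in> hom X G" "p3 \<in> hom X G"
    and commute: "g \<in> carrier G \<Longrightarrow> \<iota> g \<otimes> \<kappa> g = \<kappa> g \<otimes> \<iota> g"
    and carrier_eq: "carrier X = generate X (\<iota> ` carrier G \<union> \<kappa> ` carrier G)"
    and p1_gens [simp]: "g \<in> carrier G \<Longrightarrow> p1 (\<iota> g) = g" "g \<in> carrier G \<Longrightarrow> p1 (\<kappa> g) = \<one>\<^bsub>G\<^esub>"
    and p2_gens [simp]: "g \<in> carrier G \<Longrightarrow> p2 (\<iota> g) = \<one>\<^bsub>G\<^esub>" "g \<in> carrier G \<Longrightarrow> p2 (\<kappa> g) = g"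
    and p3_gens [simp]: "g \<in> carrier G \<Longrightarrow> p3 (\<iota> g) = g" "g \<in> carrier G \<Longrightarrow> p3 (\<kappa> g) = g"
begin

sublocale \<iota>: group_hom G X \<iota> by unfold_locales (rule homs)
sublocale \<kappa>: group_hom G X \<kappa> by unfold_locales (rule homs)
sublocale p1: group_hom X G p1 by unfold_locales (rule homs)
sublocale p2: group_hom X G p2 by unfold_locales (rule homs)
sublocale p3: group_hom X G p3 by unfold_locales (rule homs)

text \<open>Since \<open>\<iota> g\<close> and \<open>\<kappa> g\<close> range over groups, an induction over \<open>\<X>(G)\<close> needs no step for inverses.\<close>

lemma carrier_induct [consumes 1, case_names iota kappa mult]:
  assumes "x \<in> carrier X"
    and "\<And>g. g \<in> carrier G \<Longrightarrow> Q (\<iota> g)" "\<And>g. g \<in> carrier G \<Longrightarrow> Q (\<kappa> g)"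
    and "\<And>x y. x \<in> carrier X \<Longrightarrow> y \<in> carrier X \<Longrightarrow> Q x \<Longrightarrow> Q y \<Longrightarrow> Q (x \<otimes> y)"
  shows "Q x"
  using assms(1)[unfolded carrier_eq]
proof (induction rule: generate.induct)
  case one
  then show ?case using assms(2)[of "\<one>\<^bsub>G\<^esub>"] by simp
next
  case (incl h)
  then show ?case using assms(2,3) by blast
next
  case (inv h)
  then show ?case using assms(2,3) by (auto simp flip: \<iota>.hom_inv \<kappa>.hom_inv)
next
  case (eng h1 h2)
  then show ?case using assms(4) by (simp add: carrier_eq)
qed

text \<open>The elements \<open>\<iota>(g) \<kappa>(g)\<^sup>-\<^sup>1\<close>, which generate the kernel of the third projection.\<close>

definition ell :: "'c \<Rightarrow> 'a" where
  "ell g = \<iota> g \<otimes> inv (\<kappa> g)"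

lemma ell_closed [simp]: "g \<in> carrier G \<Longrightarrow> ell g \<in> carrier X"
  by (simp add: ell_def)

lemma p3_ell [simp]: "g \<in> carrier G \<Longrightarrow> p3 (ell g) = \<one>\<^bsub>G\<^esub>"
  by (simp add: ell_def)

lemma iota_eq: "g \<in> carrier G \<Longrightarrow> \<iota> g = ell g \<otimes> \<kappa> g"
  by (simp add: ell_def word_simps)

lemma ell_mult_iota:
  "g \<in> carrier G \<Longrightarrow> h \<in> carrier G \<Longrightarrow> ell (g \<otimes>\<^bsub>G\<^esub> h) = conj_by X (\<iota> g) (ell h) \<otimes> ell g"
  by (simp add: ell_def conj_by_def word_simps)

lemma ell_mult_kappa:
  "g \<in> carrier G \<Longrightarrow> h \<in> carrier G \<Longrightarrow> ell (g \<otimes>\<^bsub>G\<^esub> h) = ell g \<otimes> conj_by X (\<kappa> g) (ell h)"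
  by (simp add: ell_def conj_by_def word_simps)

lemma ell_mult_left:
  "g \<in> carrier G \<Longrightarrow> h \<in> carrier G \<Longrightarrow> ell (g \<otimes>\<^bsub>G\<^esub> h) = \<iota> g \<otimes> ell h \<otimes> inv (\<kappa> g)"
  by (simp add: ell_def word_simps)

lemma ell_inv:
  assumes "g \<in> carrier G"
  shows "ell (inv\<^bsub>G\<^esub> g) = inv (ell g)"
proof -
  have "ell (inv\<^bsub>G\<^esub> g) = inv (\<iota> g) \<otimes> (\<kappa> g \<otimes> \<iota> g) \<otimes> inv (\<iota> g)"
    using assms by (simp add: ell_def word_simps)
  also have "\<dots> = inv (ell g)"
    unfolding commute[OF assms, symmetric] using assms by (simp add: ell_def word_simps)
  finally show ?thesis .
qed

lemma conj_by_iota_ell: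
  "g \<in> carrier G \<Longrightarrow> h \<in> carrier G \<Longrightarrow> conj_by X (\<iota> g) (ell h) = ell (g \<otimes>\<^bsub>G\<^esub> h) \<otimes> inv (ell g)"
  by (simp add: ell_mult_iota word_simps)

lemma ell_alt:
  assumes "g \<in> carrier G"
  shows "ell g = inv (\<kappa> g) \<otimes> \<iota> g"
proof -
  have "inv (\<kappa> g) \<otimes> \<iota> g = inv (\<kappa> g) \<otimes> (\<iota> g \<otimes> \<kappa> g) \<otimes> inv (\<kappa> g)"
    using assms by (simp add: word_simps)
  then show ?thesis using assms by (simp add: commute ell_def word_simps)
qed

text \<open>The relation that makes the descent along the third projection work: \<open>\<ell>(g t)\<close> and \<open>\<ell>(g t\<^sup>-\<^sup>1)\<close> determine each
  other in the presence of \<open>\<ell>(g)\<close>. It holds since \<open>\<ell>(t\<^sup>-\<^sup>1) = \<ell>(t)\<^sup>-\<^sup>1\<close>, which is where the commuting of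
  \<open>\<iota>(t)\<close> and \<open>\<kappa>(t)\<close> enters.\<close>

lemma ell_symmetry:
  assumes "g \<in> carrier G" "t \<in> carrier G"
  shows "ell (g \<otimes>\<^bsub>G\<^esub> inv\<^bsub>G\<^esub> t) = ell g \<otimes> inv (ell (g \<otimes>\<^bsub>G\<^esub> t)) \<otimes> ell g"
proof -
  have "conj_by X (\<kappa> g) (ell t) = inv (ell g) \<otimes> ell (g \<otimes>\<^bsub>G\<^esub> t)"
    using assms by (simp add: ell_mult_kappa word_simps)
  moreover have "ell (g \<otimes>\<^bsub>G\<^esub> inv\<^bsub>G\<^esub> t) = ell g \<otimes> inv (conj_by X (\<kappa> g) (ell t))"
    using assms by (simp add: ell_mult_kappa ell_inv conj_by_inv)
  ultimately show ?thesis using assms by (simp add: word_simps)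
qed

text \<open>The kernel of the third projection, defined by generators; see \<open>kernel_p3\<close>.\<close>

definition L :: "'a set" where
  "L = generate X (ell ` carrier G)"

lemma L_subgroup: "subgroup L X"
  unfolding L_def by (rule generate_is_subgroup) auto

lemma conj_by_iota_L:
  assumes "g \<in> carrier G" "x \<in> L"
  shows "conj_by X (\<iota> g) x \<in> L"
proof (rule conj_by_generate[OF _ _ L_subgroup _ assms(2)[unfolded L_def]])
  fix s assume "s \<in> ell ` carrier G"
  then obtain h where h: "h \<in> carrier G" "s = ell h" by blast
  then have "ell (g \<otimes>\<^bsub>G\<^esub> h) \<in> L" "ell g \<in> L"
    using assms(1) unfolding L_def by (auto intro: generate.incl)
  then show "conj_by X (\<iota> g) s \<in> L"
    using h assms(1) L_subgroup
    by (simp add: conj_by_iota_ell subgroup.m_closed subgroup.m_inv_closed)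
qed (use assms in auto)

text \<open>\<open>\<X>(G)\<close> is the semidirect product of \<open>L\<close> and \<open>\<iota>(G)\<close>, with \<open>p3\<close> as the projection to \<open>\<iota>(G) \<cong> G\<close>.\<close>

lemma L_factor: "x \<in> carrier X \<Longrightarrow> x \<otimes> inv (\<iota> (p3 x)) \<in> L"
proof (induction rule: carrier_induct)
  case (iota g)
  then show ?case using subgroup.one_closed[OF L_subgroup] by simp
next
  case (kappa g)
  then have "\<kappa> g \<otimes> inv (\<iota> g) = inv (ell g)" by (simp add: ell_def word_simps)
  then show ?case using kappa unfolding L_def by (auto intro: generate.inv)
next
  case (mult x y)
  have "x \<otimes> y \<otimes> inv (\<iota> (p3 (x \<otimes> y))) =
    (x \<otimes> inv (\<iota> (p3 x))) \<otimes> conj_by X (\<iota> (p3 x)) (y \<otimes> inv (\<iota> (p3 y)))"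
    using mult by (simp add: conj_by_def word_simps)
  then show ?case using mult conj_by_iota_L subgroup.m_closed[OF L_subgroup] by simp
qed

lemma kernel_p3: "x \<in> carrier X \<Longrightarrow> p3 x = \<one>\<^bsub>G\<^esub> \<Longrightarrow> x \<in> L"
  using L_factor[of x] by simp

text \<open>The commutators \<open>[\<iota>(a), \<kappa>(b)]\<close> between the two copies.\<close>

definition mixed :: "'c \<Rightarrow> 'c \<Rightarrow> 'a" where
  "mixed a b = \<iota> a \<otimes> \<kappa> b \<otimes> inv (\<iota> a) \<otimes> inv (\<kappa> b)"

lemma mixed_closed [simp]: "a \<in> carrier G \<Longrightarrow> b \<in> carrier G \<Longrightarrow> mixed a b \<in> carrier X"
  by (simp add: mixed_def)

lemma conj_by_iota_mixed:
  "g \<in> carrier G \<Longrightarrow> a \<in> carrier G \<Longrightarrow> b \<in> carrier G \<Longrightarrow>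
    conj_by X (\<iota> g) (mixed a b) = mixed (g \<otimes>\<^bsub>G\<^esub> a) b \<otimes> inv (mixed g b)"
  by (simp add: mixed_def conj_by_def word_simps)

lemma conj_by_kappa_mixed:
  "g \<in> carrier G \<Longrightarrow> a \<in> carrier G \<Longrightarrow> b \<in> carrier G \<Longrightarrow>
    conj_by X (\<kappa> g) (mixed a b) = inv (mixed a g) \<otimes> mixed a (g \<otimes>\<^bsub>G\<^esub> b)"
  by (simp add: mixed_def conj_by_def word_simps)

text \<open>\<open>[\<iota>(a), \<kappa>(b)] = [\<kappa>(a), \<iota>(b)]\<close>. This follows from expanding the relation that \<open>\<iota>(c b)\<close> and \<open>\<kappa>(c b)\<close>
  commute, for \<open>c = a\<^sup>-\<^sup>1\<close>.\<close>

lemma mixed_swap: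
  assumes "a \<in> carrier G" "b \<in> carrier G"
  shows "mixed a b = \<kappa> a \<otimes> \<iota> b \<otimes> inv (\<kappa> a) \<otimes> inv (\<iota> b)"
proof -
  define c where "c = inv\<^bsub>G\<^esub> a"
  have c: "c \<in> carrier G" "a = inv\<^bsub>G\<^esub> c" using assms by (auto simp: c_def)
  let ?A = "\<iota> c" and ?B = "\<iota> b" and ?A' = "\<kappa> c" and ?B' = "\<kappa> b"
  have cl: "?A \<in> carrier X" "?B \<in> carrier X" "?A' \<in> carrier X" "?B' \<in> carrier X"
    using c assms by auto
  have AA: "?A \<otimes> inv ?A' = inv ?A' \<otimes> ?A"
  proof -
    have "inv ?A' \<otimes> (?A' \<otimes> ?A) \<otimes> inv ?A' = inv ?A' \<otimes> (?A \<otimes> ?A') \<otimes> inv ?A'"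
      using commute[OF c(1)] by simp
    then show ?thesis using cl by (simp add: word_simps)
  qed
  have *: "?A \<otimes> ?B \<otimes> (?A' \<otimes> ?B') = ?A' \<otimes> ?B' \<otimes> (?A \<otimes> ?B)"
    using commute[of "c \<otimes>\<^bsub>G\<^esub> b"] c assms by simp
  have "?A \<otimes> ?B \<otimes> ?A' \<otimes> inv ?B
      = ?A \<otimes> ?B \<otimes> (?A' \<otimes> ?B') \<otimes> inv (?B \<otimes> ?B')"
    using cl by (simp add: word_simps)
  also have "\<dots> = ?A' \<otimes> ?B' \<otimes> (?A \<otimes> ?B) \<otimes> inv (?B' \<otimes> ?B)"
    using * commute[OF assms(2)] by simp
  also have "\<dots> = ?A' \<otimes> ?B' \<otimes> ?A \<otimes> inv ?B'"
    using cl by (simp add: word_simps)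
  finally have "inv ?A \<otimes> inv ?A' \<otimes> (?A' \<otimes> ?B' \<otimes> ?A \<otimes> inv ?B')
      = inv ?A \<otimes> (inv ?A' \<otimes> ?A) \<otimes> (?B \<otimes> ?A' \<otimes> inv ?B)"
    using cl by (simp add: word_simps)
  then have "inv ?A \<otimes> ?B' \<otimes> ?A \<otimes> inv ?B' = inv ?A' \<otimes> (?B \<otimes> ?A' \<otimes> inv ?B)"
    unfolding AA[symmetric] using cl by (simp add: word_simps)
  then show ?thesis using cl c assms by (simp add: mixed_def word_simps)
qed

text \<open>\<open>\<iota>(g)\<close> and \<open>\<kappa>(g)\<close> act in the same way on mixed commutators: expand \<open>[\<iota>(g a), \<kappa>(b)]\<close> and
  \<open>[\<kappa>(g a), \<iota>(b)]\<close>, which are equal by \<open>mixed_swap\<close>.\<close>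

lemma conj_by_iota_kappa_mixed:
  assumes "g \<in> carrier G" "a \<in> carrier G" "b \<in> carrier G"
  shows "conj_by X (\<iota> g) (mixed a b) = conj_by X (\<kappa> g) (mixed a b)"
proof -
  have "conj_by X (\<iota> g) (mixed a b) = mixed (g \<otimes>\<^bsub>G\<^esub> a) b \<otimes> inv (mixed g b)"
    using assms by (rule conj_by_iota_mixed)
  also have "\<dots> = conj_by X (\<kappa> g) (mixed a b)"
    using assms by (simp add: mixed_swap conj_by_def word_simps)
  finally show ?thesis .
qed

lemma ell_commutes_mixed:
  assumes "g \<in> carrier G" "a \<in> carrier G" "b \<in> carrier G"
  shows "ell g \<otimes> mixed a b = mixed a b \<otimes> ell g"
proof -
  have "conj_by X (\<iota> g) (mixed a b) \<otimes> \<iota> g = conj_by X (\<kappa> g) (mixed a b) \<otimes> \<iota> g"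
    by (simp add: conj_by_iota_kappa_mixed[OF assms])
  then have "inv (\<kappa> g) \<otimes> \<iota> g \<otimes> mixed a b = mixed a b \<otimes> (inv (\<kappa> g) \<otimes> \<iota> g)"
    using assms by (simp add: conj_by_def word_simps)
  then show ?thesis using assms by (simp add: ell_alt)
qed

text \<open>The intersection of the kernels of the first two projections, defined by generators; see
  \<open>kernel_p1_p2\<close>.\<close>

definition D :: "'a set" where
  "D = generate X {mixed a b | a b. a \<in> carrier G \<and> b \<in> carrier G}"

lemma D_subgroup: "subgroup D X"
  unfolding D_def by (rule generate_is_subgroup) auto

lemma D_derived: "D \<subseteq> derived X (carrier X)"
  unfolding D_def derived_def mixed_def
  by (rule mono_generate) (blast intro: \<iota>.hom_closed \<kappa>.hom_closed)

lemma L_D_commute: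
  assumes "x \<in> L" "d \<in> D"
  shows "x \<otimes> d = d \<otimes> x"
  by (rule generate_commute[OF _ _ _ assms[unfolded L_def D_def]]) (auto simp: ell_commutes_mixed)

lemma conj_by_D:
  assumes "g \<in> carrier G" "d \<in> D"
  shows "conj_by X (\<iota> g) d \<in> D" "conj_by X (\<kappa> g) d \<in> D"
proof -
  have m: "mixed a b \<in> D" if "a \<in> carrier G" "b \<in> carrier G" for a b
    unfolding D_def using that by (auto intro: generate.incl)
  have sub: "{mixed a b | a b. a \<in> carrier G \<and> b \<in> carrier G} \<subseteq> carrier X" by auto
  show "conj_by X (\<iota> g) d \<in> D"
    by (rule conj_by_generate[OF _ sub D_subgroup _ assms(2)[unfolded D_def]])
      (use assms(1) m D_subgroup in \<open>auto simp: conj_by_iota_mixed subgroup.m_closed subgroup.m_inv_closed\<close>)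
  show "conj_by X (\<kappa> g) d \<in> D"
    by (rule conj_by_generate[OF _ sub D_subgroup _ assms(2)[unfolded D_def]])
      (use assms(1) m D_subgroup in \<open>auto simp: conj_by_kappa_mixed subgroup.m_closed subgroup.m_inv_closed\<close>)
qed

text \<open>Modulo \<open>D\<close> the two copies of \<open>G\<close> commute, so \<open>x\<close> is determined by its first two projections.\<close>

lemma D_factor: "x \<in> carrier X \<Longrightarrow> \<exists>d\<in>D. x = d \<otimes> (\<iota> (p1 x) \<otimes> \<kappa> (p2 x))"
proof (induction rule: carrier_induct)
  case (iota g)
  then show ?case using subgroup.one_closed[OF D_subgroup] by (intro bexI[of _ "\<one>"]) auto
next
  case (kappa g)
  then show ?case using subgroup.one_closed[OF D_subgroup] by (intro bexI[of _ "\<one>"]) auto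
next
  case (mult x y)
  then obtain d e where de: "d \<in> D" "e \<in> D"
      "x = d \<otimes> (\<iota> (p1 x) \<otimes> \<kappa> (p2 x))" "y = e \<otimes> (\<iota> (p1 y) \<otimes> \<kappa> (p2 y))" by blast
  define a b c h where abch: "a = p1 x" "b = p2 x" "c = p1 y" "h = p2 y"
  have cl: "a \<in> carrier G" "b \<in> carrier G" "c \<in> carrier G" "h \<in> carrier G"
    "d \<in> carrier X" "e \<in> carrier X"
    using mult de subgroup.mem_carrier[OF D_subgroup] by (auto simp: abch)
  let ?d = "d \<otimes> (conj_by X (\<iota> a) (conj_by X (\<kappa> b) e) \<otimes> conj_by X (\<iota> a) (inv (mixed c b)))"
  have "mixed c b \<in> D" unfolding D_def using cl by (auto intro: generate.incl)
  then have D: "?d \<in> D"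
    using de cl conj_by_D D_subgroup by (simp add: subgroup.m_closed subgroup.m_inv_closed)
  have "?d \<otimes> (\<iota> (a \<otimes>\<^bsub>G\<^esub> c) \<otimes> \<kappa> (b \<otimes>\<^bsub>G\<^esub> h))
      = d \<otimes> (\<iota> a \<otimes> \<kappa> b) \<otimes> (e \<otimes> (\<iota> c \<otimes> \<kappa> h))"
    using cl by (simp add: conj_by_def mixed_def word_simps)
  also have "\<dots> = x \<otimes> y" using de(3,4) by (simp add: abch)
  finally have "x \<otimes> y = ?d \<otimes> (\<iota> (p1 (x \<otimes> y)) \<otimes> \<kappa> (p2 (x \<otimes> y)))"
    using mult by (simp add: abch)
  then show ?case using D by blast
qed

lemma kernel_p1_p2: "x \<in> carrier X \<Longrightarrow> p1 x = \<one>\<^bsub>G\<^esub> \<Longrightarrow> p2 x = \<one>\<^bsub>G\<^esub> \<Longrightarrow> x \<in> D"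
  using D_factor[of x] subgroup.mem_carrier[OF D_subgroup] by auto

section \<open>Descent along the third projection\<close>

subsection \<open>Descent along the third projection\<close>

text \<open>Preimages under the third projection.\<close>

definition preimage :: "'c set \<Rightarrow> 'a set" where
  "preimage M = {x \<in> carrier X. p3 x \<in> M}"

lemma preimage_subgroup: "subgroup M G \<Longrightarrow> subgroup (preimage M) X"
  unfolding preimage_def
  by (rule X.subgroupI)
    (auto simp: subgroup.m_closed subgroup.m_inv_closed subgroup.one_closed
      intro!: exI[of _ "\<one>"])

text \<open>One step along the sequence \<open>\<ell>(t\<^sup>k g)\<close>: \<open>\<ell>(t g)\<close> and \<open>\<ell>(g)\<close> give \<open>\<ell>(t\<^sup>-\<^sup>1 g)\<close>, if \<open>R\<close> contains both copies
  of a subgroup \<open>M \<supseteq> G'\<close>. The subgroup \<open>M\<close> serves to interchange \<open>t g\<close> with \<open>g t\<close>, as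
  \<open>\<ell>(m h) = \<iota>(m) \<ell>(h) \<kappa>(m)\<^sup>-\<^sup>1\<close>.\<close>

lemma ell_inv_mult_mem:
  assumes "subgroup R X" "subgroup M G" "derived G (carrier G) \<subseteq> M"
    and "\<iota> ` M \<subseteq> R" "\<kappa> ` M \<subseteq> R" "t \<in> carrier G" "g \<in> carrier G"
    and "ell g \<in> R" "ell (t \<otimes>\<^bsub>G\<^esub> g) \<in> R"
  shows "ell (inv\<^bsub>G\<^esub> t \<otimes>\<^bsub>G\<^esub> g) \<in> R"
proof -
  have translate: "ell h \<in> R" if "h \<in> carrier G" "h' \<in> carrier G" "ell h' \<in> R"
      "h \<otimes>\<^bsub>G\<^esub> inv\<^bsub>G\<^esub> h' \<in> M" for h h'
  proof -
    define m where "m = h \<otimes>\<^bsub>G\<^esub> inv\<^bsub>G\<^esub> h'"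
    have "h = m \<otimes>\<^bsub>G\<^esub> h'" "m \<in> carrier G" using that by (simp_all add: m_def G.word_simps)
    then have "ell h = \<iota> m \<otimes> ell h' \<otimes> inv (\<kappa> m)"
      using that by (simp add: ell_mult_left)
    moreover have "\<iota> m \<in> R" "\<kappa> m \<in> R" using that(4) assms(4,5) by (auto simp: m_def)
    ultimately show ?thesis
      using that(3) assms(1) by (simp add: subgroup.m_closed subgroup.m_inv_closed)
  qed
  have comm: "a \<otimes>\<^bsub>G\<^esub> b \<otimes>\<^bsub>G\<^esub> inv\<^bsub>G\<^esub> (b \<otimes>\<^bsub>G\<^esub> a) \<in> M" if "a \<in> carrier G" "b \<in> carrier G" for a b
  proof -
    have "a \<otimes>\<^bsub>G\<^esub> b \<otimes>\<^bsub>G\<^esub> inv\<^bsub>G\<^esub> a \<otimes>\<^bsub>G\<^esub> inv\<^bsub>G\<^esub> b \<in> derived G (carrier G)"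
      unfolding derived_def using that by (intro generate.incl) auto
    then show ?thesis using assms(3) that by (auto simp: G.word_simps)
  qed
  have "ell (g \<otimes>\<^bsub>G\<^esub> t) \<in> R"
    using translate[of "g \<otimes>\<^bsub>G\<^esub> t" "t \<otimes>\<^bsub>G\<^esub> g"] comm assms by simp
  then have "ell (g \<otimes>\<^bsub>G\<^esub> inv\<^bsub>G\<^esub> t) \<in> R"
    using assms by (simp add: ell_symmetry subgroup.m_closed subgroup.m_inv_closed)
  then show ?thesis
    using translate[of "inv\<^bsub>G\<^esub> t \<otimes>\<^bsub>G\<^esub> g" "g \<otimes>\<^bsub>G\<^esub> inv\<^bsub>G\<^esub> t"] comm assms by simp
qed

lemma fg_preimage_step:
  assumes M: "fg_subgroup G M" "derived G (carrier G) \<subseteq> M" and t: "t \<in> carrier G"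
    and fg: "fg_subgroup X (preimage (generate G (insert t M)))"
  shows "fg_subgroup X (preimage M)"
proof -
  obtain M0 where M0: "finite M0" "M0 \<subseteq> carrier G" "M = generate G M0" and Msub: "subgroup M G"
    using G.fg_subgroupE[OF M(1)] by metis
  have Mc: "M \<subseteq> carrier G" by (rule subgroup.subset[OF Msub])
  let ?P = "preimage M"
  have P: "subgroup ?P X" by (rule preimage_subgroup[OF Msub])
  have Pc: "?P \<subseteq> carrier X" by (auto simp: preimage_def)
  have normM: "normalizes G t M"
    using G.normalizes_subgroup_derived Msub M(2) t by blast
  have conjP: "conj_by X (\<iota> s) x \<in> ?P" if "s \<in> carrier G" "x \<in> ?P" for s x
    using that Mc G.conj_by_mem[OF Msub M(2)] by (auto simp: preimage_def conj_by_def)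
  have normP: "normalizes X (\<iota> t) ?P"
    unfolding normalizes_def using conjP t by (simp flip: \<iota>.hom_inv)
  have K: "subgroup (generate G (insert t M)) G"
    using t Mc by (intro G.generate_is_subgroup) auto
  have "preimage (generate G (insert t M)) = generate X (insert (\<iota> t) ?P)"
  proof
    show "generate X (insert (\<iota> t) ?P) \<subseteq> preimage (generate G (insert t M))"
      using t by (intro X.generate_subgroup_incl preimage_subgroup K)
        (auto simp: preimage_def intro: generate.incl)
    show "preimage (generate G (insert t M)) \<subseteq> generate X (insert (\<iota> t) ?P)"
    proof
      fix x assume "x \<in> preimage (generate G (insert t M))"
      then have x: "x \<in> carrier X" "p3 x \<in> generate G (insert t M)" by (auto simp: preimage_def)
      obtain m and k :: int where m: "m \<in> M" "p3 x = m \<otimes>\<^bsub>G\<^esub> t [^]\<^bsub>G\<^esub> k"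
        using G.generate_insert_normalizing[OF t Msub normM x(2)] by blast
      let ?y = "x \<otimes> inv (\<iota> t [^] k)"
      have "?y \<in> ?P" using x m t Mc by (auto simp: preimage_def p3.hom_int_pow G.word_simps)
      then have "?y \<in> generate X (insert (\<iota> t) ?P)" by (blast intro: generate.incl)
      moreover have "\<iota> t [^] k \<in> generate X (insert (\<iota> t) ?P)"
        using X.subgroup_int_pow_closed[OF X.generate_is_subgroup, of "insert (\<iota> t) ?P" "\<iota> t" k]
          t Pc by (simp add: generate.incl)
      ultimately have "?y \<otimes> \<iota> t [^] k \<in> generate X (insert (\<iota> t) ?P)" by (rule generate.eng)
      then show "x \<in> generate X (insert (\<iota> t) ?P)" using x t by (simp add: X.word_simps)
    qed
  qed
  then obtain P0 where P0: "finite P0" "P0 \<subseteq> ?P"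
      "\<And>R. subgroup R X \<Longrightarrow> R \<subseteq> ?P \<Longrightarrow> P0 \<subseteq> R \<Longrightarrow> normalizes X (\<iota> t) R \<Longrightarrow> ?P \<subseteq> R"
    using X.fg_cyclic_extension[OF P _ normP] fg t by (metis \<iota>.hom_closed)
  have "?P \<subseteq> generate X (ell ` carrier G \<union> \<iota> ` M)"
  proof
    fix x assume "x \<in> ?P"
    then have x: "x \<in> carrier X" "p3 x \<in> M" by (auto simp: preimage_def)
    have "L \<subseteq> generate X (ell ` carrier G \<union> \<iota> ` M)"
      unfolding L_def by (intro X.mono_generate) auto
    then have "x \<otimes> inv (\<iota> (p3 x)) \<in> generate X (ell ` carrier G \<union> \<iota> ` M)"
      using L_factor[OF x(1)] by blast
    moreover have "\<iota> (p3 x) \<in> generate X (ell ` carrier G \<union> \<iota> ` M)"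
      using x by (auto intro: generate.incl)
    ultimately have "x \<otimes> inv (\<iota> (p3 x)) \<otimes> \<iota> (p3 x) \<in> generate X (ell ` carrier G \<union> \<iota> ` M)"
      by (rule generate.eng)
    then show "x \<in> generate X (ell ` carrier G \<union> \<iota> ` M)" using x by (simp add: X.word_simps)
  qed
  with P0(2) have "P0 \<subseteq> generate X (ell ` carrier G \<union> \<iota> ` M)" by (rule subset_trans)
  then obtain Y where Y: "finite Y" "Y \<subseteq> carrier G" "P0 \<subseteq> generate X (ell ` Y \<union> \<iota> ` M)"
    using X.finite_subset_generate[OF P0(1)] by metis
  \<comment> \<open>Two consecutive terms \<open>y\<close> and \<open>t y\<close> of each sequence suffice by \<open>ell_inv_mult_mem\<close>.\<close>
  define Z where "Z = insert t (Y \<union> (\<lambda>y. t \<otimes>\<^bsub>G\<^esub> y) ` Y)"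
  have Z: "finite Z" "Z \<subseteq> carrier G" using Y t by (auto simp: Z_def)
  define S where "S = ell ` Z \<union> \<iota> ` M \<union> \<kappa> ` M"
  define R where "R = generate X S"
  have Sc: "S \<subseteq> carrier X" using Z Mc by (auto simp: S_def)
  have R: "subgroup R X" unfolding R_def by (rule X.generate_is_subgroup[OF Sc])
  have "S \<subseteq> ?P"
    using Z Mc subgroup.one_closed[OF Msub] by (auto simp: S_def preimage_def)
  then have RP: "R \<subseteq> ?P" unfolding R_def by (rule X.generate_subgroup_incl[OF _ P])
  have P0R: "P0 \<subseteq> R"
    using Y(3) X.mono_generate[of "ell ` Y \<union> \<iota> ` M" S] by (auto simp: R_def S_def Z_def)
  have ellR: "ell z \<in> R" if "z \<in> Z" for z using that by (auto simp: R_def S_def intro: generate.incl)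
  have MR: "\<iota> ` M \<subseteq> R" "\<kappa> ` M \<subseteq> R" by (auto simp: R_def S_def intro: generate.incl)
  note reach = ell_inv_mult_mem[OF R Msub M(2) MR]
  have tR: "ell t \<in> R" "ell (inv\<^bsub>G\<^esub> t) \<in> R"
    using ellR[of t] t R by (auto simp: Z_def ell_inv subgroup.m_inv_closed)
  have conjR: "conj_by X (\<iota> s) x \<in> R"
    if s: "s \<in> carrier G" "ell s \<in> R" "\<And>y. y \<in> Y \<Longrightarrow> ell (s \<otimes>\<^bsub>G\<^esub> y) \<in> R \<and> ell (s \<otimes>\<^bsub>G\<^esub> (t \<otimes>\<^bsub>G\<^esub> y)) \<in> R"
      "ell (s \<otimes>\<^bsub>G\<^esub> t) \<in> R" and x: "x \<in> S" for s x
  proof -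
    consider z where "z \<in> Z" "x = ell z" | m where "m \<in> M" "x = \<iota> m" | m where "m \<in> M" "x = \<kappa> m"
      using x by (auto simp: S_def)
    then show ?thesis
    proof cases
      case 1
      have "ell (s \<otimes>\<^bsub>G\<^esub> z) \<in> R" using 1(1) s(3,4) by (auto simp: Z_def)
      moreover have "conj_by X (\<iota> s) x = ell (s \<otimes>\<^bsub>G\<^esub> z) \<otimes> inv (ell s)"
        using 1 Z s(1) by (auto simp: conj_by_iota_ell)
      ultimately show ?thesis using s(2) R by (simp add: subgroup.m_closed subgroup.m_inv_closed)
    next
      case 2
      have "conj_by X (\<iota> s) x = \<iota> (conj_by G s m)" using 2 s Mc by (auto simp: conj_by_def)
      then show ?thesis using G.conj_by_mem[OF Msub M(2) s(1) 2(1)] MR by auto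
    next
      case 3
      have "conj_by X (\<iota> s) x = conj_by X (ell s) (\<kappa> (conj_by G s m))"
        using 3 s Mc by (auto simp: conj_by_def iota_eq X.word_simps)
      moreover have "\<kappa> (conj_by G s m) \<in> R" using G.conj_by_mem[OF Msub M(2) s(1) 3(1)] MR by auto
      ultimately show ?thesis
        using s(2) R by (simp add: conj_by_def subgroup.m_closed subgroup.m_inv_closed)
    qed
  qed
  have "normalizes X (\<iota> t) R"
    unfolding R_def
  proof (rule X.normalizes_generate[OF _ Sc], goal_cases)
    case 1
    then show ?case using t by simp
  next
    case (2 x)
    \<comment> \<open>Forward steps are backward steps for \<open>t\<^sup>-\<^sup>1\<close>.\<close>
    have "ell (t \<otimes>\<^bsub>G\<^esub> t) \<in> R"
      using reach[of "inv\<^bsub>G\<^esub> t" t] t tR subgroup.one_closed[OF R]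
        by (simp add: ell_def X.r_inv)
    moreover have "ell (t \<otimes>\<^bsub>G\<^esub> (t \<otimes>\<^bsub>G\<^esub> y)) \<in> R" if "y \<in> Y" for y
      using reach[of "inv\<^bsub>G\<^esub> t" "t \<otimes>\<^bsub>G\<^esub> y"] that t Y(2) ellR[of y] ellR[of "t \<otimes>\<^bsub>G\<^esub> y"]
      by (auto simp: Z_def G.word_simps)
    ultimately have "conj_by X (\<iota> t) x \<in> R"
      using t tR ellR 2 by (intro conjR) (auto simp: Z_def)
    then show ?case by (simp add: R_def)
  next
    case (3 x)
    have "ell (inv\<^bsub>G\<^esub> t \<otimes>\<^bsub>G\<^esub> y) \<in> R" if "y \<in> Y" for y
      using reach[of t y] that t Y(2) ellR[of y] ellR[of "t \<otimes>\<^bsub>G\<^esub> y"] by (auto simp: Z_def)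
    moreover have "ell (inv\<^bsub>G\<^esub> t \<otimes>\<^bsub>G\<^esub> (t \<otimes>\<^bsub>G\<^esub> y)) \<in> R" if "y \<in> Y" for y
      using that t Y(2) ellR[of y] by (auto simp: Z_def G.word_simps)
    moreover have "ell (inv\<^bsub>G\<^esub> t \<otimes>\<^bsub>G\<^esub> t) \<in> R"
      using t subgroup.one_closed[OF R] by (simp add: ell_def X.r_inv)
    ultimately have "conj_by X (\<iota> (inv\<^bsub>G\<^esub> t)) x \<in> R"
      using t tR 3 by (intro conjR) auto
    then show ?case using t by (simp add: R_def)
  qed
  then have "?P \<subseteq> R" using P0(3)[OF R RP P0R] by blast
  then have "?P = R" using RP by blast
  moreover have "R = generate X (ell ` Z \<union> \<iota> ` M0 \<union> \<kappa> ` M0)"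
  proof
    have sub: "subgroup (generate X (ell ` Z \<union> \<iota> ` M0 \<union> \<kappa> ` M0)) X"
      using Z M0 by (intro X.generate_is_subgroup) auto
    have "\<iota> ` M \<subseteq> generate X (\<iota> ` M0)" "\<kappa> ` M \<subseteq> generate X (\<kappa> ` M0)"
      using \<iota>.generate_img[OF M0(2)] \<kappa>.generate_img[OF M0(2)] M0(3) by auto
    moreover have "generate X (\<iota> ` M0) \<subseteq> generate X (ell ` Z \<union> \<iota> ` M0 \<union> \<kappa> ` M0)"
      "generate X (\<kappa> ` M0) \<subseteq> generate X (ell ` Z \<union> \<iota> ` M0 \<union> \<kappa> ` M0)"
      by (intro X.mono_generate; auto)+
    ultimately have "S \<subseteq> generate X (ell ` Z \<union> \<iota> ` M0 \<union> \<kappa> ` M0)"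
      unfolding S_def by (auto intro: generate.incl)
    then show "R \<subseteq> generate X (ell ` Z \<union> \<iota> ` M0 \<union> \<kappa> ` M0)"
      unfolding R_def by (rule X.generate_subgroup_incl[OF _ sub])
    show "generate X (ell ` Z \<union> \<iota> ` M0 \<union> \<kappa> ` M0) \<subseteq> R"
      unfolding R_def S_def using M0(3) G.subset_generate[of M0] by (intro X.mono_generate) auto
  qed
  moreover have "fg_subgroup X (generate X (ell ` Z \<union> \<iota> ` M0 \<union> \<kappa> ` M0))"
    using Z M0(1,2) by (intro X.fg_subgroup_generate) auto
  ultimately show ?thesis by simp
qed

lemma fg_carrier:
  assumes "fg_subgroup G (carrier G)"
  shows "fg_subgroup X (carrier X)"
proof -
  obtain S where S: "finite S" "S \<subseteq> carrier G" "carrier G = generate G S"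
    using G.fg_subgroupE[OF assms] by metis
  have "carrier X = generate X (\<iota> ` S \<union> \<kappa> ` S)"
  proof
    have sub: "subgroup (generate X (\<iota> ` S \<union> \<kappa> ` S)) X"
      using S by (intro X.generate_is_subgroup) auto
    then show "generate X (\<iota> ` S \<union> \<kappa> ` S) \<subseteq> carrier X" by (rule subgroup.subset)
    have "\<iota> ` carrier G \<subseteq> generate X (\<iota> ` S)" "\<kappa> ` carrier G \<subseteq> generate X (\<kappa> ` S)"
      using \<iota>.generate_img[OF S(2)] \<kappa>.generate_img[OF S(2)] S(3) by auto
    moreover have "generate X (\<iota> ` S) \<subseteq> generate X (\<iota> ` S \<union> \<kappa> ` S)"
      "generate X (\<kappa> ` S) \<subseteq> generate X (\<iota> ` S \<union> \<kappa> ` S)"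
      by (intro X.mono_generate; auto)+
    ultimately show "carrier X \<subseteq> generate X (\<iota> ` S \<union> \<kappa> ` S)"
      unfolding carrier_eq by (intro X.generate_subgroup_incl[OF _ sub]) auto
  qed
  moreover have "fg_subgroup X (generate X (\<iota> ` S \<union> \<kappa> ` S))"
    using S(1,2) by (intro X.fg_subgroup_generate) auto
  ultimately show ?thesis by simp
qed

lemma fg_preimage:
  assumes "fg_subgroup G (carrier G)" "fg_subgroup G M" "derived G (carrier G) \<subseteq> M"
  shows "fg_subgroup X (preimage M)"
proof -
  have descend: "fg_subgroup X (preimage M)"
    if "finite T" "T \<subseteq> carrier G" "fg_subgroup G M" "derived G (carrier G) \<subseteq> M"
      "fg_subgroup X (preimage (generate G (M \<union> T)))" for T M
    using that
  proof (induction T arbitrary: M rule: finite_induct)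
    case empty
    have "subgroup M G" using empty by (simp add: fg_subgroup_def)
    then have "generate G M = M"
      using G.generate_subgroup_incl[of M M] G.subset_generate[of M] by blast
    then show ?case using empty by simp
  next
    case (insert t T)
    let ?K = "generate G (insert t M)"
    have Mc: "M \<subseteq> carrier G" using insert(5) subgroup.subset[of M G] by (simp add: fg_subgroup_def)
    have "generate G (?K \<union> T) = generate G (M \<union> insert t T)"
      using G.generate_Un_generate[of "insert t M" T] Mc insert(4) by simp
    moreover have "derived G (carrier G) \<subseteq> ?K" using insert(6) by (auto intro: generate.incl)
    ultimately have "fg_subgroup X (preimage ?K)"
      using insert.prems by (intro insert.IH[of ?K] G.fg_subgroup_insert) simp_all
    then show ?case using insert.prems by (intro fg_preimage_step[of M t]) simp_all
  qed
  obtain S where S: "finite S" "S \<subseteq> carrier G" "carrier G = generate G S"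
    using G.fg_subgroupE[OF assms(1)] by metis
  have Mc: "M \<subseteq> carrier G" using assms(2) subgroup.subset[of M G] by (simp add: fg_subgroup_def)
  have "generate G (M \<union> S) = carrier G"
    using S Mc G.mono_generate[of S "M \<union> S"] G.generate_incl[of "M \<union> S"] by auto
  moreover have "preimage (carrier G) = carrier X" by (auto simp: preimage_def)
  ultimately show ?thesis
    using descend[OF S(1,2) assms(2,3)] fg_carrier[OF assms(1)] by simp
qed

section \<open>Descent along the kernel of the third projection\<close>

text \<open>Let \<open>P \<supseteq> \<X>(G)'\<close>. If \<open>\<langle>P, l\<rangle>\<close>, \<open>p1(P)\<close> and \<open>p2(P)\<close> are finitely generated, then \<open>P\<close> is finitely generated modulo \<open>D\<close>; two
  elements are congruent modulo \<open>D\<close> if their images under \<open>p1\<close> and \<open>p2\<close> agree.\<close>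

lemma fg_modulo_D:
  assumes P: "subgroup P X" "derived X (carrier X) \<subseteq> P"
    and fg1: "fg_subgroup G (p1 ` P)" and fg2: "fg_subgroup G (p2 ` P)"
    and l: "l \<in> carrier X" and fg: "fg_subgroup X (generate X (insert l P))"
  obtains A where "finite A" "A \<subseteq> P"
    "\<And>p. p \<in> P \<Longrightarrow> \<exists>r\<in>generate X A. p1 r = p1 p \<and> p2 r = p2 p"
proof -
  have Pc: "P \<subseteq> carrier X" by (rule subgroup.subset[OF P(1)])
  obtain P0 where P0: "finite P0" "P0 \<subseteq> P"
      "\<And>R. subgroup R X \<Longrightarrow> R \<subseteq> P \<Longrightarrow> P0 \<subseteq> R \<Longrightarrow> normalizes X l R \<Longrightarrow> P \<subseteq> R"
    using X.fg_cyclic_extension[OF P(1) l X.normalizes_subgroup_derived[OF P l] fg] by metis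
  obtain S1 where S1: "finite S1" "S1 \<subseteq> p1 ` P" "p1 ` P = generate G S1"
    using G.fg_subgroupE[OF fg1] by metis
  obtain S2 where S2: "finite S2" "S2 \<subseteq> p2 ` P" "p2 ` P = generate G S2"
    using G.fg_subgroupE[OF fg2] by metis
  obtain A1 where A1: "A1 \<subseteq> P" "finite A1" "S1 = p1 ` A1"
    using finite_subset_image[OF S1(1,2)] by metis
  obtain A2 where A2: "A2 \<subseteq> P" "finite A2" "S2 = p2 ` A2"
    using finite_subset_image[OF S2(1,2)] by metis
  define A where "A = P0 \<union> A1 \<union> A2"
  have A: "finite A" "A \<subseteq> P" using P0 A1 A2 by (auto simp: A_def)
  let ?u1 = "p1 l" and ?u2 = "p2 l"
  \<comment> \<open>Displacements of the generators of the two projections, each placed in one factor of \<open>G \<times> G\<close>.\<close>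
  define B where "B = A \<union> ((\<lambda>a. \<iota> (G.displacement ?u1 (p1 a))) ` A \<union> (\<lambda>a. \<kappa> (G.displacement ?u2 (p2 a))) ` A)"
  have disp: "\<iota> (G.displacement u x) \<in> P" "\<kappa> (G.displacement u x) \<in> P"
    if "u \<in> carrier G" "x \<in> carrier G" for u x
  proof -
    have *: "inv b \<otimes> a \<otimes> inv (inv b) \<otimes> inv a \<in> P"
      if "a \<in> carrier X" "b \<in> carrier X" for a b
    proof -
      have "inv b \<otimes> a \<otimes> inv (inv b) \<otimes> inv a \<in> derived X (carrier X)"
        unfolding derived_def using that by (intro generate.incl) blast
      then show ?thesis using P(2) by blast
    qed
    show "\<iota> (G.displacement u x) \<in> P" "\<kappa> (G.displacement u x) \<in> P"
      using *[of "\<iota> u" "\<iota> x"] *[of "\<kappa> u" "\<kappa> x"] that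
      by (simp_all add: G.displacement_def conj_by_def X.word_simps)
  qed
  have u: "?u1 \<in> carrier G" "?u2 \<in> carrier G" using l by auto
  have BP: "B \<subseteq> P"
    using A(2) Pc disp u by (auto simp: B_def)
  have B: "finite B" "B \<subseteq> carrier X" using A(1) BP Pc by (auto simp: B_def)
  define R where "R = generate X B"
  have R: "subgroup R X" unfolding R_def by (rule X.generate_is_subgroup[OF B(2)])
  have RP: "R \<subseteq> P" unfolding R_def by (rule X.generate_subgroup_incl[OF BP P(1)])
  have AR: "A \<subseteq> R" by (auto simp: R_def B_def intro: generate.incl)
  have Rc: "R \<subseteq> carrier X" using RP Pc by blast
  have img1: "p1 ` P = generate G (p1 ` A)"
    by (rule G.generate_between[OF p1.subgroup_img_is_subgroup[OF P(1)] S1(3)])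
      (use A1(3) A(2) in \<open>auto simp: A_def\<close>)
  have img2: "p2 ` P = generate G (p2 ` A)"
    by (rule G.generate_between[OF p2.subgroup_img_is_subgroup[OF P(1)] S2(3)])
      (use A2(3) A(2) in \<open>auto simp: A_def\<close>)
  have imgR1: "p1 ` R = p1 ` P"
  proof
    show "p1 ` R \<subseteq> p1 ` P" using RP by blast
    show "p1 ` P \<subseteq> p1 ` R" unfolding img1
      using AR by (intro G.generate_subgroup_incl p1.subgroup_img_is_subgroup[OF R]) auto
  qed
  have imgR2: "p2 ` R = p2 ` P"
  proof
    show "p2 ` R \<subseteq> p2 ` P" using RP by blast
    show "p2 ` P \<subseteq> p2 ` R" unfolding img2
      using AR by (intro G.generate_subgroup_incl p2.subgroup_img_is_subgroup[OF R]) auto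
  qed
  have R1: "p1 ` R = generate G (p1 ` A)" using imgR1 img1 by simp
  have R2: "p2 ` R = generate G (p2 ` A)" using imgR2 img2 by simp
  have Z1: "\<exists>r\<in>R. p1 r = G.displacement ?u1 x \<and> p2 r = \<one>\<^bsub>G\<^esub>" if "x \<in> p1 ` P" for x
  proof (rule p1.displacement_transfer[OF p2.group_hom_axioms R AR R1 u(1)])
    fix a assume a: "a \<in> A"
    then have "p1 a \<in> carrier G" using A(2) Pc by auto
    then show "\<exists>r\<in>R. p1 r = G.displacement ?u1 (p1 a) \<and> p2 r = \<one>\<^bsub>G\<^esub>"
      using a u by (intro bexI[of _ "\<iota> (G.displacement ?u1 (p1 a))"])
        (auto simp: R_def B_def intro: generate.incl)
  qed (use that imgR1 in simp)
  have Z2: "\<exists>r\<in>R. p2 r = G.displacement ?u2 x \<and> p1 r = \<one>\<^bsub>G\<^esub>" if "x \<in> p2 ` P" for x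
  proof (rule p2.displacement_transfer[OF p1.group_hom_axioms R AR R2 u(2)])
    fix a assume a: "a \<in> A"
    then have "p2 a \<in> carrier G" using A(2) Pc by auto
    then show "\<exists>r\<in>R. p2 r = G.displacement ?u2 (p2 a) \<and> p1 r = \<one>\<^bsub>G\<^esub>"
      using a u by (intro bexI[of _ "\<kappa> (G.displacement ?u2 (p2 a))"])
        (auto simp: R_def B_def intro: generate.incl)
  qed (use that imgR2 in simp)
  \<comment> \<open>\<open>S\<close> is the product of \<open>R\<close> and \<open>D\<close>. It is normalized by \<open>l\<close> although \<open>R\<close> need not be.\<close>
  define S where "S = {x \<in> carrier X. \<exists>r\<in>R. p1 r = p1 x \<and> p2 r = p2 x}"
  have SI: "x \<in> S" if "x \<in> carrier X" "r \<in> R" "p1 r = p1 x" "p2 r = p2 x" for x r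
    using that by (auto simp: S_def)
  have S: "subgroup S X"
  proof (rule X.subgroupI)
    show "S \<subseteq> carrier X" by (auto simp: S_def)
    have "\<one> \<in> S" using SI[of "\<one>" "\<one>"] subgroup.one_closed[OF R] by simp
    then show "S \<noteq> {}" by blast
  next
    fix x assume "x \<in> S"
    then obtain r where "x \<in> carrier X" "r \<in> R" "p1 r = p1 x" "p2 r = p2 x" by (auto simp: S_def)
    then show "inv x \<in> S"
      using Rc subgroup.m_inv_closed[OF R] by (intro SI[of _ "inv r"]) auto
  next
    fix x y assume "x \<in> S" "y \<in> S"
    then obtain r s where "x \<in> carrier X" "r \<in> R" "p1 r = p1 x" "p2 r = p2 x"
      "y \<in> carrier X" "s \<in> R" "p1 s = p1 y" "p2 s = p2 y" by (auto simp: S_def)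
    moreover from this have "r \<in> carrier X" "s \<in> carrier X" using Rc by auto
    ultimately show "x \<otimes> y \<in> S"
      using subgroup.m_closed[OF R] by (intro SI[of _ "r \<otimes> s"]) auto
  qed
  have SP: "S \<subseteq> P"
  proof
    fix x assume "x \<in> S"
    then obtain r where r: "x \<in> carrier X" "r \<in> R" "p1 r = p1 x" "p2 r = p2 x" by (auto simp: S_def)
    then have "r \<in> carrier X" using Rc by blast
    then have "inv r \<otimes> x \<in> D" using r by (intro kernel_p1_p2) auto
    then have "r \<otimes> (inv r \<otimes> x) \<in> P"
      using D_derived P r(2) RP subgroup.m_closed[OF P(1)] by blast
    then show "x \<in> P" using r \<open>r \<in> carrier X\<close> by (simp add: X.word_simps)
  qed
  have RS: "R \<subseteq> S" using Rc SI by blast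
  have conjS: "conj_by X l x \<in> S" "conj_by X (inv l) x \<in> S" if "x \<in> S" for x
  proof -
    from that obtain r where r: "x \<in> carrier X" "r \<in> R" "p1 r = p1 x" "p2 r = p2 x"
      by (auto simp: S_def)
    have x: "x \<in> P" using that SP by blast
    have y: "conj_by X (inv l) x \<in> P" using X.conj_by_mem[OF P _ x] l by simp
    obtain z1 z2 where z: "z1 \<in> R" "p1 z1 = G.displacement ?u1 (p1 x)" "p2 z1 = \<one>\<^bsub>G\<^esub>"
        "z2 \<in> R" "p2 z2 = G.displacement ?u2 (p2 x)" "p1 z2 = \<one>\<^bsub>G\<^esub>"
      using Z1[of "p1 x"] Z2[of "p2 x"] x by blast
    have zc: "r \<in> carrier X" "z1 \<in> carrier X" "z2 \<in> carrier X" using z r Rc by auto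
    have "r \<otimes> z1 \<otimes> z2 \<in> R" using r z R by (simp add: subgroup.m_closed)
    then show "conj_by X l x \<in> S"
    proof (rule SI[rotated])
      show "p1 (r \<otimes> z1 \<otimes> z2) = p1 (conj_by X l x)"
        using zc z r l by (simp add: conj_by_def G.displacement_def G.word_simps)
      show "p2 (r \<otimes> z1 \<otimes> z2) = p2 (conj_by X l x)"
        using zc z r l by (simp add: conj_by_def G.displacement_def G.word_simps)
    qed (use l r in simp)
    \<comment> \<open>\<open>u\<^sup>-\<^sup>1 x u\<close> is \<open>x\<close> times the inverse of the displacement of \<open>u\<^sup>-\<^sup>1 x u\<close> by \<open>u\<close>.\<close>
    obtain w1 w2 where w: "w1 \<in> R" "p1 w1 = G.displacement ?u1 (p1 (conj_by X (inv l) x))" "p2 w1 = \<one>\<^bsub>G\<^esub>"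
        "w2 \<in> R" "p2 w2 = G.displacement ?u2 (p2 (conj_by X (inv l) x))" "p1 w2 = \<one>\<^bsub>G\<^esub>"
      using Z1 Z2 imageI[OF y, of p1] imageI[OF y, of p2] by blast
    have wc: "w1 \<in> carrier X" "w2 \<in> carrier X" using w Rc by auto
    have "r \<otimes> inv w1 \<otimes> inv w2 \<in> R"
      using r w R by (simp add: subgroup.m_closed subgroup.m_inv_closed)
    then show "conj_by X (inv l) x \<in> S"
    proof (rule SI[rotated])
      show "p1 (r \<otimes> inv w1 \<otimes> inv w2) = p1 (conj_by X (inv l) x)"
        using zc wc w r l by (simp add: conj_by_def G.displacement_def G.word_simps)
      show "p2 (r \<otimes> inv w1 \<otimes> inv w2) = p2 (conj_by X (inv l) x)"
        using zc wc w r l by (simp add: conj_by_def G.displacement_def G.word_simps)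
    qed (use l r in simp)
  qed
  have "P \<subseteq> S"
    using P0(3)[OF S SP] AR RS conjS by (auto simp: A_def normalizes_def)
  then show ?thesis
    using that[OF B(1) BP] by (auto simp: S_def R_def)
qed

text \<open>For \<open>l\<close> in \<open>L\<close> generators modulo \<open>D\<close> are enough: conjugation by \<open>l\<close> maps each of finitely many generators
  into their span up to a factor in \<open>D\<close>, and adding these factors ends the process because \<open>l\<close>
  centralizes \<open>D\<close>.\<close>

lemma fg_subgroup_kernel_step:
  assumes P: "subgroup P X" "derived X (carrier X) \<subseteq> P"
    and fg12: "fg_subgroup G (p1 ` P)" "fg_subgroup G (p2 ` P)"
    and l: "l \<in> L" and fg: "fg_subgroup X (generate X (insert l P))"
  shows "fg_subgroup X P"
proof -
  have Pc: "P \<subseteq> carrier X" by (rule subgroup.subset[OF P(1)])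
  have lc: "l \<in> carrier X" using l subgroup.mem_carrier[OF L_subgroup] by blast
  obtain P0 where P0: "finite P0" "P0 \<subseteq> P"
      "\<And>R. subgroup R X \<Longrightarrow> R \<subseteq> P \<Longrightarrow> P0 \<subseteq> R \<Longrightarrow> normalizes X l R \<Longrightarrow> P \<subseteq> R"
    using X.fg_cyclic_extension[OF P(1) lc X.normalizes_subgroup_derived[OF P lc] fg] by metis
  obtain A where A: "finite A" "A \<subseteq> P"
      "\<And>p. p \<in> P \<Longrightarrow> \<exists>r\<in>generate X A. p1 r = p1 p \<and> p2 r = p2 p"
    using fg_modulo_D[OF P fg12 lc fg] by metis
  obtain \<rho> where \<rho>: "\<And>p. p \<in> P \<Longrightarrow> \<rho> p \<in> generate X A \<and> p1 (\<rho> p) = p1 p \<and> p2 (\<rho> p) = p2 p"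
    using A(3) by metis
  \<comment> \<open>\<open>\<rho>\<close> chooses representatives modulo \<open>D\<close>, and \<open>d\<close> is the error in \<open>D\<close>.\<close>
  define d where "d = (\<lambda>p. inv (\<rho> p) \<otimes> p)"
  have AP: "generate X A \<subseteq> P" by (rule X.generate_subgroup_incl[OF A(2) P(1)])
  have \<rho>c: "\<rho> p \<in> carrier X" if "p \<in> P" for p using \<rho>[OF that] AP Pc by blast
  have d: "d p \<in> D" "p = \<rho> p \<otimes> d p" if "p \<in> P" for p
  proof -
    have "p \<in> carrier X" using that Pc by blast
    then show "p = \<rho> p \<otimes> d p" using \<rho>c[OF that] by (simp add: d_def X.word_simps)
    show "d p \<in> D"
      unfolding d_def using \<open>p \<in> carrier X\<close> \<rho>[OF that] \<rho>c[OF that] by (intro kernel_p1_p2) auto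
  qed
  define B where "B = P0 \<union> A"
  define C where "C = d ` (conj_by X l ` B \<union> conj_by X (inv l) ` B)"
  have BP: "B \<subseteq> P" using P0 A by (auto simp: B_def)
  have conjP: "conj_by X l p \<in> P" "conj_by X (inv l) p \<in> P" if "p \<in> P" for p
    using X.conj_by_mem[OF P] that lc by auto
  have CD: "C \<subseteq> D" using BP conjP d by (auto simp: C_def)
  then have BCP: "B \<union> C \<subseteq> P" using BP D_derived P(2) by blast
  then have BCc: "B \<union> C \<subseteq> carrier X" using Pc by blast
  define R where "R = generate X (B \<union> C)"
  have R: "subgroup R X" unfolding R_def by (rule X.generate_is_subgroup[OF BCc])
  have RP: "R \<subseteq> P" unfolding R_def by (rule X.generate_subgroup_incl[OF BCP P(1)])
  have "generate X A \<subseteq> R" unfolding R_def B_def by (intro X.mono_generate) auto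
  then have \<rho>R: "\<rho> p \<in> R" if "p \<in> P" for p using \<rho>[OF that] by blast
  have CR: "C \<subseteq> R" by (auto simp: R_def intro: generate.incl)
  have key: "conj_by X e x \<in> R" if e: "e \<in> {l, inv l}" and x: "x \<in> B \<union> C" for e x
  proof (cases "x \<in> C")
    case True
    have "e \<in> L" using e l subgroup.m_inv_closed[OF L_subgroup] by auto
    then have "e \<otimes> x = x \<otimes> e" using L_D_commute True CD by blast
    moreover have "e \<in> carrier X" "x \<in> carrier X" using e lc x BCc by auto
    ultimately have "conj_by X e x = x" by (simp add: conj_by_def X.word_simps)
    then show ?thesis using True CR by auto
  next
    case False
    then have x: "x \<in> B" using x by blast
    have c: "conj_by X e x \<in> P" using e x BP conjP by blast
    have "d (conj_by X e x) \<in> R" using e x CR by (auto simp: C_def)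
    then have "\<rho> (conj_by X e x) \<otimes> d (conj_by X e x) \<in> R"
      using \<rho>R[OF c] subgroup.m_closed[OF R] by blast
    then show ?thesis using d(2)[OF c] by simp
  qed
  have "normalizes X l R"
    unfolding R_def by (rule X.normalizes_generate[OF lc BCc]) (use key in \<open>auto simp: R_def\<close>)
  moreover have "P0 \<subseteq> R" by (auto simp: R_def B_def intro: generate.incl)
  ultimately have "P = R" using P0(3)[OF R RP] RP by blast
  moreover have "finite (B \<union> C)" using P0 A by (simp add: B_def C_def)
  ultimately show ?thesis
    using X.fg_subgroup_generate[OF _ BCc] by (simp add: R_def)
qed

lemma fg_subgroup_image:
  assumes "group_hom X G q" "fg_subgroup X P"
  shows "fg_subgroup G (q ` P)"
proof -
  interpret q: group_hom X G q by fact
  obtain S where S: "finite S" "S \<subseteq> carrier X" "P = generate X S"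
    using X.fg_subgroupE[OF assms(2)] by metis
  then have "q ` P = generate G (q ` S)" using q.generate_img by auto
  moreover have "q ` S \<subseteq> carrier G" using S(2) by auto
  ultimately show ?thesis using S(1) G.fg_subgroup_generate[of "q ` S"] by simp
qed

lemma projections_derived:
  "p1 ` derived X (carrier X) = derived G (carrier G)"
  "p2 ` derived X (carrier X) = derived G (carrier G)"
  "p3 ` derived X (carrier X) = derived G (carrier G)"
proof -
  have surj: "q ` carrier X = carrier G"
    if "q \<in> hom X G" "s \<in> hom G X" "\<And>g. g \<in> carrier G \<Longrightarrow> q (s g) = g" for q s
  proof
    show "q ` carrier X \<subseteq> carrier G" using that(1) by (auto simp: hom_def)
    have "g = q (s g)" "s g \<in> carrier X" if "g \<in> carrier G" for g
      using that \<open>s \<in> hom G X\<close> \<open>\<And>g. g \<in> carrier G \<Longrightarrow> q (s g) = g\<close> by (auto simp: hom_def)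
    then show "carrier G \<subseteq> q ` carrier X" by blast
  qed
  have "p1 ` carrier X = carrier G" "p2 ` carrier X = carrier G" "p3 ` carrier X = carrier G"
    using surj[OF homs(3,1)] surj[OF homs(4,2)] surj[OF homs(5,1)] by simp_all
  then show "p1 ` derived X (carrier X) = derived G (carrier G)"
    "p2 ` derived X (carrier X) = derived G (carrier G)"
    "p3 ` derived X (carrier X) = derived G (carrier G)"
    using p1.derived_img[of "carrier X"] p2.derived_img[of "carrier X"] p3.derived_img[of "carrier X"]
    by simp_all
qed

lemma fg_subgroup_iff_projections:
  assumes "fg_subgroup G (carrier G)" "subgroup N X" "derived X (carrier X) \<subseteq> N"
  shows "fg_subgroup X N \<longleftrightarrow>
    fg_subgroup G (p1 ` N) \<and> fg_subgroup G (p2 ` N) \<and> fg_subgroup G (p3 ` N)"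
proof
  assume "fg_subgroup X N"
  then show "fg_subgroup G (p1 ` N) \<and> fg_subgroup G (p2 ` N) \<and> fg_subgroup G (p3 ` N)"
    using fg_subgroup_image p1.group_hom_axioms p2.group_hom_axioms p3.group_hom_axioms by blast
next
  assume fg: "fg_subgroup G (p1 ` N) \<and> fg_subgroup G (p2 ` N) \<and> fg_subgroup G (p3 ` N)"
  have descend: "fg_subgroup X P"
    if "finite T" "T \<subseteq> L" "subgroup P X" "derived X (carrier X) \<subseteq> P"
      "fg_subgroup G (p1 ` P)" "fg_subgroup G (p2 ` P)" "fg_subgroup X (generate X (P \<union> T))" for T P
    using that
  proof (induction T arbitrary: P rule: finite_induct)
    case empty
    then have "generate X P = P"
      using X.generate_subgroup_incl[of P P] X.subset_generate[of P] by blast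
    then show ?case using empty by simp
  next
    case (insert l T)
    let ?K = "generate X (insert l P)"
    have Pc: "P \<subseteq> carrier X" using insert.prems(2) by (rule subgroup.subset)
    have Lc: "L \<subseteq> carrier X" by (rule subgroup.subset[OF L_subgroup])
    have l: "l \<in> L" "l \<in> carrier X" using insert.prems(1) Lc by auto
    have lPc: "insert l P \<subseteq> carrier X" using l Pc by blast
    have "generate X (?K \<union> T) = generate X (P \<union> insert l T)"
      using X.generate_Un_generate[of "insert l P" T] lPc insert.prems(1) Lc by auto
    moreover have "derived X (carrier X) \<subseteq> ?K"
      using insert.prems(3) by (auto intro: generate.incl)
    moreover have "p1 ` ?K = generate G (insert (p1 l) (p1 ` P))"
      "p2 ` ?K = generate G (insert (p2 l) (p2 ` P))"
      using p1.generate_img[OF lPc] p2.generate_img[OF lPc] by auto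
    moreover have "fg_subgroup G (generate G (insert (p1 l) (p1 ` P)))"
      "fg_subgroup G (generate G (insert (p2 l) (p2 ` P)))"
      using insert.prems(4,5) l by (auto intro: G.fg_subgroup_insert)
    ultimately have "fg_subgroup X ?K"
      using insert.prems(1,6) X.generate_is_subgroup[OF lPc] by (intro insert.IH[of ?K]) simp_all
    then show ?case using insert.prems l by (intro fg_subgroup_kernel_step[of P l]) simp_all
  qed
  have Nc: "N \<subseteq> carrier X" by (rule subgroup.subset[OF assms(2)])
  have "derived G (carrier G) \<subseteq> p3 ` N" using projections_derived(3) assms(3) by blast
  then have "fg_subgroup X (preimage (p3 ` N))" using fg_preimage[OF assms(1)] fg by blast
  then obtain S where S: "finite S" "S \<subseteq> preimage (p3 ` N)" "S \<subseteq> carrier X"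
      "preimage (p3 ` N) = generate X S" "subgroup (preimage (p3 ` N)) X"
    using X.fg_subgroupE by metis
  have "\<forall>s\<in>S. \<exists>n. n \<in> N \<and> p3 s = p3 n" using S(2) by (auto simp: preimage_def)
  from bchoice[OF this] obtain n where n: "\<And>s. s \<in> S \<Longrightarrow> n s \<in> N \<and> p3 s = p3 (n s)" by blast
  define T where "T = (\<lambda>s. inv (n s) \<otimes> s) ` S"
  have T: "finite T" "T \<subseteq> L"
  proof -
    show "finite T" using S by (simp add: T_def)
    have "inv (n s) \<otimes> s \<in> L" if "s \<in> S" for s
    proof -
      have "s \<in> carrier X" "n s \<in> carrier X" using n[OF that] that S(3) Nc by auto
      then show ?thesis using n[OF that] by (intro kernel_p3) auto
    qed
    then show "T \<subseteq> L" by (auto simp: T_def)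
  qed
  have NT: "N \<union> T \<subseteq> preimage (p3 ` N)"
    using Nc T(2) subgroup.subset[OF L_subgroup] n S(3) subgroup.one_closed[OF assms(2)]
    by (auto simp: preimage_def T_def subset_iff intro!: image_eqI[of _ _ "\<one>"])
  have "preimage (p3 ` N) = generate X (N \<union> T)"
  proof
    have sub: "subgroup (generate X (N \<union> T)) X"
      using NT by (intro X.generate_is_subgroup) (auto simp: preimage_def)
    have "s \<in> generate X (N \<union> T)" if "s \<in> S" for s
    proof -
      have "n s \<otimes> (inv (n s) \<otimes> s) \<in> generate X (N \<union> T)"
        using n[OF that] that by (intro generate.eng generate.incl) (auto simp: T_def)
      then show ?thesis using n[OF that] that S(3) Nc by (simp add: X.word_simps subset_iff)
    qed
    then show "preimage (p3 ` N) \<subseteq> generate X (N \<union> T)"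
      unfolding S(4) by (intro X.generate_subgroup_incl[OF _ sub]) blast
    show "generate X (N \<union> T) \<subseteq> preimage (p3 ` N)"
      by (rule X.generate_subgroup_incl[OF NT S(5)])
  qed
  then show "fg_subgroup X N"
    using descend[OF T assms(2,3)] fg \<open>fg_subgroup X (preimage (p3 ` N))\<close> by simp
qed

end

section \<open>The weak commutativity construction\<close>

lemma pres_class_inv_letter:
  assumes "x \<in> Y"
  shows "pres_class Y R [(x, False)] = inv\<^bsub>presented_group Y R\<^esub> (pres_class Y R [(x, True)])"
proof -
  interpret group "presented_group Y R" by (rule group_presented_group)
  have "pres_eq Y R [(x, False), (x, True)] []"
    using pres_eq.cancel[of "[]" Y "[]" x R False] assms by simp
  then have "pres_class Y R [(x, False)] \<otimes>\<^bsub>presented_group Y R\<^esub> pres_class Y R [(x, True)]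
      = \<one>\<^bsub>presented_group Y R\<^esub>"
    using assms by (simp add: presented_group_mult presented_group_one pres_class_eq_iff)
  then show ?thesis
    using assms by (intro inv_equality[symmetric]) (auto simp: presented_group_carrier)
qed

text \<open>The class of a word is the product of the classes of its letters.\<close>

lemma word_eval_generators:
  "w \<in> words Y \<Longrightarrow> word_eval (presented_group Y R) (\<lambda>x. pres_class Y R [(x, True)]) w = pres_class Y R w"
proof (induction w)
  case Nil
  then show ?case by (simp add: presented_group_one)
next
  case (Cons a w)
  obtain x e where a: "a = (x, e)" by (cases a)
  have "(if e then pres_class Y R [(x, True)]
      else inv\<^bsub>presented_group Y R\<^esub> (pres_class Y R [(x, True)])) = pres_class Y R [(x, e)]"
    using Cons.prems a by (auto simp: pres_class_inv_letter)
  then show ?case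
    using Cons a by (simp add: presented_group_mult)
qed

lemma word_eval_relator:
  assumes "r \<in> R" "r \<in> words Y"
  shows "word_eval (presented_group Y R) (\<lambda>x. pres_class Y R [(x, True)]) r = \<one>\<^bsub>presented_group Y R\<^esub>"
proof -
  have "pres_eq Y R r []" using pres_eq.relator[of "[]" Y "[]" r R] assms by simp
  then show ?thesis
    using assms by (simp add: word_eval_generators presented_group_one pres_class_eq_iff)
qed

lemma presented_group_generated:
  "carrier (presented_group Y R) = generate (presented_group Y R) ((\<lambda>x. pres_class Y R [(x, True)]) ` Y)"
    (is "_ = generate ?P (?f ` Y)")
proof
  interpret group ?P by (rule group_presented_group)
  have f: "?f ` Y \<subseteq> carrier ?P" by (auto simp: presented_group_carrier)
  then show "generate ?P (?f ` Y) \<subseteq> carrier ?P" by (rule generate_incl)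
  have "word_eval ?P ?f w \<in> generate ?P (?f ` Y)" if "w \<in> words Y" for w
    using that
  proof (induction w)
    case Nil
    then show ?case by (simp add: generate.one)
  next
    case (Cons a w)
    obtain x e where a: "a = (x, e)" by (cases a)
    then show ?case using Cons by (auto intro!: generate.eng intro: generate.incl generate.inv)
  qed
  then show "carrier ?P \<subseteq> generate ?P (?f ` Y)"
    by (auto simp: presented_group_carrier word_eval_generators)
qed

lemma (in group) weak_comm_relators:
  assumes "g \<in> carrier G" "h \<in> carrier G"
  shows "weak_comm_gen G (Inl (g \<otimes> h)) = weak_comm_gen G (Inl g) \<otimes>\<^bsub>weak_comm G\<^esub> weak_comm_gen G (Inl h)"
    and "weak_comm_gen G (Inr (g \<otimes> h)) = weak_comm_gen G (Inr g) \<otimes>\<^bsub>weak_comm G\<^esub> weak_comm_gen G (Inr h)"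
    and "weak_comm_gen G (Inl g) \<otimes>\<^bsub>weak_comm G\<^esub> weak_comm_gen G (Inr g)
      = weak_comm_gen G (Inr g) \<otimes>\<^bsub>weak_comm G\<^esub> weak_comm_gen G (Inl g)"
proof -
  interpret X: group "weak_comm G" by (rule weak_comm_is_group)
  have rel: "word_eval (weak_comm G) (weak_comm_gen G) r = \<one>\<^bsub>weak_comm G\<^esub>"
    if "r \<in> weak_comm_rels G" "r \<in> words (weak_comm_gens G)" for r
    using word_eval_relator[OF that] unfolding weak_comm_def weak_comm_gen_def .
  note gens = weak_comm_gen_closed
  have solve: "c = a \<otimes>\<^bsub>weak_comm G\<^esub> b"
    if "a \<in> carrier (weak_comm G)" "b \<in> carrier (weak_comm G)" "c \<in> carrier (weak_comm G)"
      "a \<otimes>\<^bsub>weak_comm G\<^esub> (b \<otimes>\<^bsub>weak_comm G\<^esub> inv\<^bsub>weak_comm G\<^esub> c) = \<one>\<^bsub>weak_comm G\<^esub>" for a b c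
  proof -
    have "(a \<otimes>\<^bsub>weak_comm G\<^esub> (b \<otimes>\<^bsub>weak_comm G\<^esub> inv\<^bsub>weak_comm G\<^esub> c)) \<otimes>\<^bsub>weak_comm G\<^esub> c = c"
      using that by simp
    then show ?thesis using that(1-3) by (simp add: X.word_simps)
  qed
  have "word_eval (weak_comm G) (weak_comm_gen G) [(Inl g, True), (Inl h, True), (Inl (g \<otimes> h), False)]
      = \<one>\<^bsub>weak_comm G\<^esub>"
    using assms by (intro rel) (auto simp: weak_comm_rels_def weak_comm_gens_def)
  then show "weak_comm_gen G (Inl (g \<otimes> h)) = weak_comm_gen G (Inl g) \<otimes>\<^bsub>weak_comm G\<^esub> weak_comm_gen G (Inl h)"
    using assms gens by (intro solve) auto
  have "word_eval (weak_comm G) (weak_comm_gen G) [(Inr g, True), (Inr h, True), (Inr (g \<otimes> h), False)]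
      = \<one>\<^bsub>weak_comm G\<^esub>"
    using assms by (intro rel) (auto simp: weak_comm_rels_def weak_comm_gens_def)
  then show "weak_comm_gen G (Inr (g \<otimes> h)) = weak_comm_gen G (Inr g) \<otimes>\<^bsub>weak_comm G\<^esub> weak_comm_gen G (Inr h)"
    using assms gens by (intro solve) auto
  have "word_eval (weak_comm G) (weak_comm_gen G) [(Inl g, True), (Inr g, True), (Inl g, False), (Inr g, False)]
      = \<one>\<^bsub>weak_comm G\<^esub>"
    using assms by (intro rel) (auto simp: weak_comm_rels_def weak_comm_gens_def)
  then have "weak_comm_gen G (Inr g) \<otimes>\<^bsub>weak_comm G\<^esub> weak_comm_gen G (Inl g)
      = weak_comm_gen G (Inl g) \<otimes>\<^bsub>weak_comm G\<^esub> weak_comm_gen G (Inr g)"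
    using assms gens by (intro solve) (auto simp: X.inv_mult_group)
  then show "weak_comm_gen G (Inl g) \<otimes>\<^bsub>weak_comm G\<^esub> weak_comm_gen G (Inr g)
      = weak_comm_gen G (Inr g) \<otimes>\<^bsub>weak_comm G\<^esub> weak_comm_gen G (Inl g)" by simp
qed

text \<open>The presented group \<open>\<X>(G)\<close> is an instance of the axiomatic situation.\<close>

lemma (in group) weak_commutativity_weak_comm:
  "weak_commutativity (weak_comm G) G (\<lambda>g. weak_comm_gen G (Inl g)) (\<lambda>g. weak_comm_gen G (Inr g))
     (pi1 G) (pi2 G) (pi3 G)"
proof -
  interpret X: group "weak_comm G" by (rule weak_comm_is_group)
  show ?thesis
  proof unfold_locales
    show "(\<lambda>g. weak_comm_gen G (Inl g)) \<in> hom G (weak_comm G)"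
      "(\<lambda>g. weak_comm_gen G (Inr g)) \<in> hom G (weak_comm G)"
      using weak_comm_gen_closed weak_comm_relators(1,2) by (auto intro!: homI)
    show "carrier (weak_comm G) = generate (weak_comm G)
        ((\<lambda>g. weak_comm_gen G (Inl g)) ` carrier G \<union> (\<lambda>g. weak_comm_gen G (Inr g)) ` carrier G)"
      using presented_group_generated[of "weak_comm_gens G" "weak_comm_rels G"]
      unfolding weak_comm_def weak_comm_gen_def weak_comm_gens_def by (simp add: image_Un image_image)
  qed (auto simp: pi1_props pi2_props pi3_props weak_comm_relators(3))
qed

theorem corollaryB2:
  fixes G :: "('a, 'b) monoid_scheme"
  assumes "group G"
    and "fg_subgroup G (carrier G)"
  shows "(\<forall>N. subgroup N (weak_comm G) \<and> derived (weak_comm G) (carrier (weak_comm G)) \<subseteq> N \<longrightarrow>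
            (fg_subgroup (weak_comm G) N \<longleftrightarrow>
               fg_subgroup G (pi1 G ` N) \<and> fg_subgroup G (pi2 G ` N) \<and> fg_subgroup G (pi3 G ` N)))
       \<and> (fg_subgroup (weak_comm G) (derived (weak_comm G) (carrier (weak_comm G))) \<longleftrightarrow>
            fg_subgroup G (derived G (carrier G)))"
proof -
  interpret weak_commutativity "weak_comm G" G "\<lambda>g. weak_comm_gen G (Inl g)"
    "\<lambda>g. weak_comm_gen G (Inr g)" "pi1 G" "pi2 G" "pi3 G"
    by (rule group.weak_commutativity_weak_comm[OF assms(1)])
  have "subgroup (derived (weak_comm G) (carrier (weak_comm G))) (weak_comm G)"
    by (rule X.derived_is_subgroup) simp
  from fg_subgroup_iff_projections[OF assms(2) this order_refl] show ?thesis
    using fg_subgroup_iff_projections[OF assms(2)] by (auto simp: projections_derived)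
qed

end
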